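(* Let $R$ be a commutative ring and $I$ an ideal of $R$. Let $M$ be a finitely generated projective $R$-module of rank at least $2$, and let $N=R\oplus M$. Then $\mathrm{Trans}(N,IN)=\mathrm{ETrans}(N,IN)$.
   Context: $M^*=\mathrm{Hom}_R(M,R)$. An element $q$ of a module $M$ is unimodular if $\phi(q)=1$ for some $\phi\in M^*$; $\mathrm{Um}(M)$ is the set of unimodular elements. For a finitely generated module $N$, a transvection of $N$ is an automorphism $1+\pi_q$, where $\pi_q(p)=\pi(p)q$, $q\in N$, $\pi\in N^*$, $\pi(q)=0$, and either $q\in\mathrm{Um}(N)$ or $\pi\in\mathrm{Um}(N^* )$. $\mathrm{Trans}(N,IN)$ is the group generated by the transvections $1+\pi_q$ with either $q\in IN$ or $\pi\in IN^*$. For $N=R\oplus M$, the elementary transvections are $E_x:(a,p)\mapsto(a,p+ax)$ ($x\in M$) and $E^*_\tau:(a,p)\mapsto(a+\tau(p),p)$ ($\tau\in M^*$). $\mathrm{ETrans}(N)$ is the group they generate; $\mathrm{ETrans}(IN)$ is the subgroup generated by the $E_x,E^*_\tau$ with $x\in IM$, $\tau\in IM^*$; $\mathrm{ETrans}(N,IN)$ is the normal closure of $\mathrm{ETrans}(IN)$ in $\mathrm{ETrans}(N)$. *)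

theory Defs
  imports "HOL-Algebra.Algebra"
begin

text \<open>
  The record type \<open>('a, 'b) module\<close> extends \<open>'b ring\<close>, so it has the fields \<open>mult\<close> and \<open>one\<close>,
  which the locale \<open>module\<close> never looks at. For modules that are not rings they are left \<open>undefined\<close>.
\<close>

section \<open>Modules\<close>

definition reg_module :: "('a, 'm) ring_scheme \<Rightarrow> ('a, 'a) module" where
  "reg_module R = \<lparr>carrier = carrier R, monoid.mult = monoid.mult R, monoid.one = \<one>\<^bsub>R\<^esub>,
     ring.zero = \<zero>\<^bsub>R\<^esub>, ring.add = ring.add R, smult = monoid.mult R\<rparr>"

definition direct_sum ::
    "('a, 'b, 'm) module_scheme \<Rightarrow> ('a, 'c, 'n) module_scheme \<Rightarrow> ('a, 'b \<times> 'c) module" where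
  "direct_sum M N = \<lparr>carrier = carrier M \<times> carrier N,
     monoid.mult = undefined, monoid.one = undefined,
     ring.zero = (\<zero>\<^bsub>M\<^esub>, \<zero>\<^bsub>N\<^esub>),
     ring.add = (\<lambda>(x, y) (x', y'). (x \<oplus>\<^bsub>M\<^esub> x', y \<oplus>\<^bsub>N\<^esub> y')),
     smult = (\<lambda>a (x, y). (a \<odot>\<^bsub>M\<^esub> x, a \<odot>\<^bsub>N\<^esub> y))\<rparr>"

definition mod_hom ::
    "('a, 'k) ring_scheme \<Rightarrow> ('a, 'b, 'm) module_scheme \<Rightarrow> ('a, 'c, 'n) module_scheme
      \<Rightarrow> ('b \<Rightarrow> 'c) set" where
  "mod_hom R M N = {f \<in> hom (add_monoid M) (add_monoid N).
     \<forall>a\<in>carrier R. \<forall>x\<in>carrier M. f (a \<odot>\<^bsub>M\<^esub> x) = a \<odot>\<^bsub>N\<^esub> f x}"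

text \<open>Functionals are taken to be extensional, so that equal functionals are equal as HOL functions.\<close>

definition dual ::
    "('a, 'k) ring_scheme \<Rightarrow> ('a, 'b, 'm) module_scheme \<Rightarrow> ('a, 'b \<Rightarrow> 'a) module" where
  "dual R M = \<lparr>carrier = mod_hom R M (reg_module R) \<inter> extensional (carrier M),
     monoid.mult = undefined, monoid.one = undefined,
     ring.zero = (\<lambda>x\<in>carrier M. \<zero>\<^bsub>R\<^esub>),
     ring.add = (\<lambda>f g. \<lambda>x\<in>carrier M. f x \<oplus>\<^bsub>R\<^esub> g x),
     smult = (\<lambda>a f. \<lambda>x\<in>carrier M. a \<otimes>\<^bsub>R\<^esub> f x)\<rparr>"

definition unimodular ::
    "('a, 'k) ring_scheme \<Rightarrow> ('a, 'b, 'm) module_scheme \<Rightarrow> 'b set" where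
  "unimodular R M = {q \<in> carrier M. \<exists>\<phi>\<in>carrier (dual R M). \<phi> q = \<one>\<^bsub>R\<^esub>}"

definition mod_span ::
    "('a, 'k) ring_scheme \<Rightarrow> ('a, 'b, 'm) module_scheme \<Rightarrow> 'b set \<Rightarrow> 'b set" where
  "mod_span R M B = \<Inter>{H. submodule H R M \<and> B \<subseteq> H}"

definition ideal_smult ::
    "('a, 'k) ring_scheme \<Rightarrow> 'a set \<Rightarrow> ('a, 'b, 'm) module_scheme \<Rightarrow> 'b set" where
  "ideal_smult R I M = mod_span R M {i \<odot>\<^bsub>M\<^esub> x | i x. i \<in> I \<and> x \<in> carrier M}"

definition finitely_generated ::
    "('a, 'k) ring_scheme \<Rightarrow> ('a, 'b, 'm) module_scheme \<Rightarrow> bool" where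
  "finitely_generated R M \<longleftrightarrow>
     (\<exists>B. finite B \<and> B \<subseteq> carrier M \<and> mod_span R M B = carrier M)"

definition free_module :: "('a, 'k) ring_scheme \<Rightarrow> 'b set \<Rightarrow> ('a, 'b \<Rightarrow> 'a) module" where
  "free_module R B =
     \<lparr>carrier = {c \<in> B \<rightarrow>\<^sub>E carrier R. finite {x \<in> B. c x \<noteq> \<zero>\<^bsub>R\<^esub>}},
      monoid.mult = undefined, monoid.one = undefined,
      ring.zero = (\<lambda>x\<in>B. \<zero>\<^bsub>R\<^esub>),
      ring.add = (\<lambda>c d. \<lambda>x\<in>B. c x \<oplus>\<^bsub>R\<^esub> d x),
      smult = (\<lambda>a c. \<lambda>x\<in>B. a \<otimes>\<^bsub>R\<^esub> c x)\<rparr>"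

text \<open>
  Direct summand of a free module. The types of the index set \<open>B\<close> and of the complement \<open>Q\<close> are no
  restriction: the free module on the set \<open>carrier M\<close> maps onto \<open>M\<close>, and if \<open>M\<close> is projective
  then the kernel of that map is a complement.
\<close>

definition projective ::
    "('a, 'k) ring_scheme \<Rightarrow> ('a, 'b, 'm) module_scheme \<Rightarrow> bool" where
  "projective R M \<longleftrightarrow>
     (\<exists>(B :: 'b set) (Q :: ('a, 'b \<Rightarrow> 'a) module) f. module R Q \<and>
        f \<in> mod_hom R (direct_sum M Q) (free_module R B) \<and>
        bij_betw f (carrier (direct_sum M Q)) (carrier (free_module R B)))"


section \<open>Localization and rank\<close>

definition frac_rel ::
    "('a, 'k) ring_scheme \<Rightarrow> 'a set \<Rightarrow> ('a, 'b, 'm) module_scheme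
      \<Rightarrow> (('b \<times> 'a) \<times> ('b \<times> 'a)) set" where
  "frac_rel R S M = {((m, s), (n, t)).
     m \<in> carrier M \<and> n \<in> carrier M \<and> s \<in> S \<and> t \<in> S \<and>
     (\<exists>u\<in>S. u \<odot>\<^bsub>M\<^esub> (t \<odot>\<^bsub>M\<^esub> m) = u \<odot>\<^bsub>M\<^esub> (s \<odot>\<^bsub>M\<^esub> n))}"

text \<open>\<open>fraction R S M (m, s)\<close> is the fraction \<open>m/s\<close>.\<close>

definition fraction ::
    "('a, 'k) ring_scheme \<Rightarrow> 'a set \<Rightarrow> ('a, 'b, 'm) module_scheme
      \<Rightarrow> 'b \<times> 'a \<Rightarrow> ('b \<times> 'a) set" where
  "fraction R S M p = frac_rel R S M `` {p}"

text \<open>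
  The unions below run over all representatives of the two fractions; all the sets united are equal.
\<close>

definition loc_module ::
    "('a, 'k) ring_scheme \<Rightarrow> 'a set \<Rightarrow> ('a, 'b, 'm) module_scheme
      \<Rightarrow> (('a \<times> 'a) set, ('b \<times> 'a) set) module" where
  "loc_module R S M = \<lparr>carrier = (carrier M \<times> S) // frac_rel R S M,
     monoid.mult = undefined, monoid.one = undefined,
     ring.zero = fraction R S M (\<zero>\<^bsub>M\<^esub>, \<one>\<^bsub>R\<^esub>),
     ring.add = (\<lambda>U V. \<Union>(m, s)\<in>U. \<Union>(n, t)\<in>V.
              fraction R S M (t \<odot>\<^bsub>M\<^esub> m \<oplus>\<^bsub>M\<^esub> s \<odot>\<^bsub>M\<^esub> n, s \<otimes>\<^bsub>R\<^esub> t)),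
     smult = (\<lambda>A U. \<Union>(a, s)\<in>A. \<Union>(m, t)\<in>U. fraction R S M (a \<odot>\<^bsub>M\<^esub> m, s \<otimes>\<^bsub>R\<^esub> t))\<rparr>"

definition loc_ring ::
    "('a, 'k) ring_scheme \<Rightarrow> 'a set \<Rightarrow> ('a \<times> 'a) set ring" where
  "loc_ring R S =
     \<lparr>carrier = carrier (loc_module R S (reg_module R)),
      monoid.mult = smult (loc_module R S (reg_module R)),
      monoid.one = fraction R S (reg_module R) (\<one>\<^bsub>R\<^esub>, \<one>\<^bsub>R\<^esub>),
      ring.zero = ring.zero (loc_module R S (reg_module R)),
      ring.add = ring.add (loc_module R S (reg_module R))\<rparr>"

definition free_of_rank ::
    "('a, 'k) ring_scheme \<Rightarrow> ('a, 'b, 'm) module_scheme \<Rightarrow> nat \<Rightarrow> bool" where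
  "free_of_rank R M n \<longleftrightarrow> (\<exists>e \<in> {..<n} \<rightarrow> carrier M. \<forall>x\<in>carrier M.
     \<exists>!c. c \<in> {..<n} \<rightarrow>\<^sub>E carrier R \<and> x = (\<Oplus>\<^bsub>M\<^esub>i\<in>{..<n}. c i \<odot>\<^bsub>M\<^esub> e i))"

text \<open>
  The rank of a finitely generated projective module \<open>M\<close> is the function sending a prime ideal \<open>P\<close>
  to the rank of the free \<open>R\<^sub>P\<close>-module \<open>M\<^sub>P\<close>; it is not required to be constant.
\<close>

definition rank_at_least ::
    "('a, 'k) ring_scheme \<Rightarrow> ('a, 'b, 'm) module_scheme \<Rightarrow> nat \<Rightarrow> bool" where
  "rank_at_least R M k \<longleftrightarrow> (\<forall>P. primeideal P R \<longrightarrow>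
     (\<exists>n\<ge>k. free_of_rank (loc_ring R (carrier R - P)) (loc_module R (carrier R - P) M) n))"


section \<open>Transvections\<close>

definition Aut_mod ::
    "('a, 'k) ring_scheme \<Rightarrow> ('a, 'b, 'm) module_scheme \<Rightarrow> ('b \<Rightarrow> 'b) monoid" where
  "Aut_mod R N = BijGroup (carrier N) \<lparr>carrier := mod_hom R N N \<inter> Bij (carrier N)\<rparr>"

definition transvection ::
    "('a, 'b, 'm) module_scheme \<Rightarrow> ('b \<Rightarrow> 'a) \<Rightarrow> 'b \<Rightarrow> ('b \<Rightarrow> 'b)" where
  "transvection N \<pi> q = (\<lambda>p\<in>carrier N. p \<oplus>\<^bsub>N\<^esub> \<pi> p \<odot>\<^bsub>N\<^esub> q)"

definition Trans ::
    "('a, 'k) ring_scheme \<Rightarrow> ('a, 'b, 'm) module_scheme \<Rightarrow> 'a set \<Rightarrow> ('b \<Rightarrow> 'b) set" where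
  "Trans R N I = generate (Aut_mod R N)
     {transvection N \<pi> q | \<pi> q. q \<in> carrier N \<and> \<pi> \<in> carrier (dual R N) \<and> \<pi> q = \<zero>\<^bsub>R\<^esub> \<and>
        (q \<in> unimodular R N \<or> \<pi> \<in> unimodular R (dual R N)) \<and>
        (q \<in> ideal_smult R I N \<or> \<pi> \<in> ideal_smult R I (dual R N))}"

definition elem_trans ::
    "('a, 'k) ring_scheme \<Rightarrow> ('a, 'b, 'm) module_scheme \<Rightarrow> 'b \<Rightarrow> ('a \<times> 'b \<Rightarrow> 'a \<times> 'b)" where
  "elem_trans R M x = (\<lambda>(a, p) \<in> carrier R \<times> carrier M. (a, p \<oplus>\<^bsub>M\<^esub> a \<odot>\<^bsub>M\<^esub> x))"

definition elem_trans_dual ::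
    "('a, 'k) ring_scheme \<Rightarrow> ('a, 'b, 'm) module_scheme \<Rightarrow> ('b \<Rightarrow> 'a)
      \<Rightarrow> ('a \<times> 'b \<Rightarrow> 'a \<times> 'b)" where
  "elem_trans_dual R M \<tau> = (\<lambda>(a, p) \<in> carrier R \<times> carrier M. (a \<oplus>\<^bsub>R\<^esub> \<tau> p, p))"

text \<open>
  The three groups below consist of automorphisms of \<open>R \<oplus> M\<close> but depend on the decomposition,
  so they take \<open>M\<close> and not \<open>R \<oplus> M\<close> as an argument.
\<close>

definition ETrans ::
    "('a, 'k) ring_scheme \<Rightarrow> ('a, 'b, 'm) module_scheme \<Rightarrow> ('a \<times> 'b \<Rightarrow> 'a \<times> 'b) set" where
  "ETrans R M = generate (Aut_mod R (direct_sum (reg_module R) M))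
     (elem_trans R M ` carrier M \<union> elem_trans_dual R M ` carrier (dual R M))"

definition ETrans_ideal ::
    "('a, 'k) ring_scheme \<Rightarrow> ('a, 'b, 'm) module_scheme \<Rightarrow> 'a set
      \<Rightarrow> ('a \<times> 'b \<Rightarrow> 'a \<times> 'b) set" where
  "ETrans_ideal R M I = generate (Aut_mod R (direct_sum (reg_module R) M))
     (elem_trans R M ` ideal_smult R I M \<union> elem_trans_dual R M ` ideal_smult R I (dual R M))"

definition normal_closure :: "('a, 'm) monoid_scheme \<Rightarrow> 'a set \<Rightarrow> 'a set" where
  "normal_closure G B = \<Inter>{H. H \<lhd> G \<and> B \<subseteq> H}"

definition ETrans_rel ::
    "('a, 'k) ring_scheme \<Rightarrow> ('a, 'b, 'm) module_scheme \<Rightarrow> 'a set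
      \<Rightarrow> ('a \<times> 'b \<Rightarrow> 'a \<times> 'b) set" where
  "ETrans_rel R M I =
     normal_closure (Aut_mod R (direct_sum (reg_module R) M) \<lparr>carrier := ETrans R M\<rparr>)
       (ETrans_ideal R M I)"

end

theory Submission
  imports Defs
begin

text \<open>
  Write \<open>q \<otimes> \<pi>\<close> for the endomorphism \<open>p \<mapsto> \<pi>(p)q\<close>. Three rules govern the transvections \<open>1 + q \<otimes> \<pi>\<close>
  with \<open>\<pi>(q) = 0\<close>. They are additive in \<open>q\<close> for fixed \<open>\<pi>\<close> and in \<open>\<pi>\<close> for fixed \<open>q\<close>, scalars move
  across the tensor sign, and the commutator of \<open>1 + v \<otimes> \<chi>\<close> and \<open>1 + z \<otimes> w\<close> is
  \<open>1 + \<chi>(z) v \<otimes> w\<close> whenever \<open>w(v) = 0\<close>. Let \<open>e = (1, 0)\<close> in \<open>N = R \<oplus> M\<close> and let \<open>e'\<close> be the first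
  projection, so that \<open>M\<close> consists of the vectors killed by \<open>e'\<close>, \<open>M\<^sup>*\<close> of the functionals that kill
  \<open>e\<close>, and the elementary transvections are the \<open>1 + x \<otimes> e'\<close> and \<open>1 + e \<otimes> \<tau>\<close>.

  The inclusion of \<open>Trans\<close> in \<open>ETrans\<close> is obtained by explicit commutators; no passage to the free case
  over local rings is made. Let \<open>H\<close> be a normal subgroup of \<open>ETrans(N)\<close> that contains \<open>ETrans(IN)\<close>.
  Taking commutators with \<open>1 + z \<otimes> e'\<close> shows that \<open>1 + z \<otimes> w\<close> lies in \<open>H\<close> if \<open>z \<in> M\<close> or if
  \<open>w \<in> M\<^sup>*\<close>, where \<open>w \<in> IN\<^sup>*\<close> (\<open>t_mem_H_left\<close>, \<open>t_mem_H_right\<close>). Now let \<open>\<pi> \<in> IN\<^sup>*\<close> and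
  \<open>\<phi>(q) = 1\<close>. The Koszul identity \<open>\<pi> = \<phi>(q)\<pi> - \<pi>(q)\<phi>\<close> exhibits \<open>\<pi>\<close> as the contraction of the form
  \<open>\<phi> \<and> \<pi>\<close> with \<open>q\<close>; up to a functional in \<open>M\<^sup>*\<close> that kills \<open>q\<close> this leaves
  \<open>w = e'(q) \<theta> - \<theta>(q) e'\<close> with \<open>\<theta> \<in> IM\<^sup>*\<close> (\<open>t_unimodular_mem_H\<close>). For such \<open>w\<close> the rank is needed. If
  \<open>z \<in> M\<close> and \<open>\<sigma> \<in> M\<^sup>*\<close> satisfy \<open>w(z) = 0\<close> and \<open>\<sigma>(z) = c\<close>, then \<open>cq\<close> differs by a multiple of \<open>z\<close>
  from a vector \<open>v\<close> with \<open>\<sigma>(v) = 0\<close>, and \<open>1 + cv \<otimes> w\<close> is the commutator of \<open>1 + v \<otimes> \<sigma>\<close> and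
  \<open>1 + z \<otimes> w\<close>; hence \<open>1 + q \<otimes> c\<^sup>2w\<close> lies in \<open>H\<close> (\<open>t_square_mem_H\<close>). A two-by-two minor
  \<open>c = \<rho>(x)\<sigma>(y) - \<rho>(y)\<sigma>(x)\<close> on \<open>M\<close> lets one split \<open>cw\<close> into two functionals of this kind, so
  \<open>1 + q \<otimes> c\<^sup>3w\<close> lies in \<open>H\<close>. The scalars \<open>d\<close> for which all \<open>1 + q \<otimes> rdw\<close> lie in \<open>H\<close> form an ideal, and
  since \<open>M\<close> has rank at least two at every prime, no prime contains all the minors
  (\<open>minor_notin_prime\<close>); thus the ideal contains \<open>1\<close> (\<open>t_hyperbolic_mem_H\<close>).

  If instead \<open>\<pi>\<close> is unimodular, the same argument applies with \<open>N\<close> and \<open>N\<^sup>*\<close> exchanged, because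
  \<open>M\<close> is reflexive and the three rules are symmetric up to a sign; this is why the commutator
  argument is carried out for two abstract modules in duality. In the mixed cases, \<open>q\<close> unimodular in
  \<open>IN\<close> or \<open>\<pi>\<close> unimodular in \<open>IN\<^sup>*\<close>, one has \<open>I = R\<close>.

  For the opposite inclusion, conjugation by any automorphism permutes the generators of
  \<open>Trans(N, IN)\<close>, so that this group is normal in all automorphisms. It lies in \<open>ETrans(N)\<close> by the first
  half, applied to \<open>H = ETrans(N)\<close>, and contains the generators of \<open>ETrans(IN)\<close>.
\<close>

section \<open>Existence of prime ideals\<close>

text \<open>
  By Zorn's lemma there is an ideal maximal among those that contain \<open>A\<close> but not \<open>\<one>\<close>; it is a
  maximal ideal.
\<close>

lemma (in cring) ex_primeideal_containing:
  assumes "ideal A R" "\<one> \<notin> A"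
  shows "\<exists>P. primeideal P R \<and> A \<subseteq> P"
proof -
  define S where "S = {J. ideal J R \<and> A \<subseteq> J \<and> \<one> \<notin> J}"
  have "\<exists>P\<in>S. \<forall>J\<in>S. P \<subseteq> J \<longrightarrow> J = P"
  proof (rule subset_Zorn_nonempty)
    show "S \<noteq> {}" using assms by (auto simp: S_def)
  next
    fix C assume C: "C \<noteq> {}" "subset.chain S C"
    then have "subset.chain {J. ideal J R} C" and *: "C \<subseteq> S"
      by (auto simp: pred_on.chain_def S_def)
    then have "ideal (\<Union>C) R" using chain_Union_is_ideal[of C] C(1) by simp
    then show "\<Union>C \<in> S" using * C(1) by (auto simp: S_def)
  qed
  then obtain P where P: "ideal P R" "A \<subseteq> P" "\<one> \<notin> P"
    and max: "\<And>J. ideal J R \<Longrightarrow> A \<subseteq> J \<Longrightarrow> \<one> \<notin> J \<Longrightarrow> P \<subseteq> J \<Longrightarrow> J = P"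
    by (auto simp: S_def)
  have "maximalideal P R"
  proof (rule maximalidealI[OF P(1)])
    show "carrier R \<noteq> P" using P(3) by auto
  next
    fix J assume J: "ideal J R" "P \<subseteq> J" "J \<subseteq> carrier R"
    show "J = P \<or> J = carrier R"
    proof (cases "\<one> \<in> J")
      case True then show ?thesis using J(1) ideal.one_imp_carrier by blast
    next
      case False then show ?thesis using max J P(2) by blast
    qed
  qed
  then show ?thesis using maximalideal_prime P(2) by blast
qed

section \<open>Commutator calculus of transvections\<close>

text \<open>
  For a module \<open>N\<close> and its dual \<open>N'\<close> the form is evaluation. Keeping \<open>N'\<close> abstract makes the situation
  symmetric in the two modules, without identifying \<open>N\<close> with its double dual.
\<close>

locale module_pairing = R: cring R + N: module R N + N': module R N'
  for R :: "('a, 'k) ring_scheme" (structure)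
    and N :: "('a, 'n, 'i) module_scheme" and N' :: "('a, 'p, 'j) module_scheme" +
  fixes B :: "'p \<Rightarrow> 'n \<Rightarrow> 'a"
  assumes B_closed [simp, intro]:
      "\<lbrakk>f \<in> carrier N'; x \<in> carrier N\<rbrakk> \<Longrightarrow> B f x \<in> carrier R"
    and B_add_left [simp]: "\<lbrakk>f \<in> carrier N'; g \<in> carrier N'; x \<in> carrier N\<rbrakk> \<Longrightarrow>
      B (f \<oplus>\<^bsub>N'\<^esub> g) x = B f x \<oplus> B g x"
    and B_add_right [simp]: "\<lbrakk>f \<in> carrier N'; x \<in> carrier N; y \<in> carrier N\<rbrakk> \<Longrightarrow>
      B f (x \<oplus>\<^bsub>N\<^esub> y) = B f x \<oplus> B f y"
    and B_smult_left [simp]: "\<lbrakk>a \<in> carrier R; f \<in> carrier N'; x \<in> carrier N\<rbrakk> \<Longrightarrow>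
      B (a \<odot>\<^bsub>N'\<^esub> f) x = a \<otimes> B f x"
    and B_smult_right [simp]: "\<lbrakk>a \<in> carrier R; f \<in> carrier N'; x \<in> carrier N\<rbrakk> \<Longrightarrow>
      B f (a \<odot>\<^bsub>N\<^esub> x) = a \<otimes> B f x"
begin

lemma B_neg_left [simp]:
  assumes "f \<in> carrier N'" "x \<in> carrier N"
  shows "B (\<ominus>\<^bsub>N'\<^esub> f) x = \<ominus> B f x"
  using B_smult_left[of "\<ominus> \<one>" f x] assms by (simp add: N'.smult_l_minus R.l_minus)

lemma B_neg_right [simp]:
  assumes "f \<in> carrier N'" "x \<in> carrier N"
  shows "B f (\<ominus>\<^bsub>N\<^esub> x) = \<ominus> B f x"
  using B_smult_right[of "\<ominus> \<one>" f x] assms by (simp add: N.smult_l_minus R.l_minus)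

lemma B_diff [simp]:
  assumes "f \<in> carrier N'" "x \<in> carrier N"
  shows "g \<in> carrier N' \<Longrightarrow> B (f \<ominus>\<^bsub>N'\<^esub> g) x = B f x \<ominus> B g x"
    and "y \<in> carrier N \<Longrightarrow> B f (x \<ominus>\<^bsub>N\<^esub> y) = B f x \<ominus> B f y"
  using assms by (simp_all add: a_minus_def)

end

text \<open>
  The element \<open>t x f\<close> of \<open>G\<close> stands for \<open>1 + x \<otimes> f\<close>. The last law is the commutator formula: it says
  that \<open>t x (B f y \<odot> g)\<close> is the commutator of \<open>t x f\<close> and \<open>t y g\<close>, without mention of inverses.
\<close>

locale transvection_system = module_pairing R N N' B + G: group G
  for R :: "('a, 'k) ring_scheme" (structure)
    and N :: "('a, 'n, 'i) module_scheme" and N' :: "('a, 'p, 'j) module_scheme" and B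
    and G :: "('g, 'l) monoid_scheme" +
  fixes t :: "'n \<Rightarrow> 'p \<Rightarrow> 'g"
  assumes t_closed: "\<lbrakk>x \<in> carrier N; f \<in> carrier N'; B f x = \<zero>\<rbrakk> \<Longrightarrow> t x f \<in> carrier G"
    and t_add_left: "\<lbrakk>x \<in> carrier N; y \<in> carrier N; f \<in> carrier N'; B f x = \<zero>; B f y = \<zero>\<rbrakk> \<Longrightarrow>
      t (x \<oplus>\<^bsub>N\<^esub> y) f = t x f \<otimes>\<^bsub>G\<^esub> t y f"
    and t_add_right: "\<lbrakk>x \<in> carrier N; f \<in> carrier N'; g \<in> carrier N'; B f x = \<zero>; B g x = \<zero>\<rbrakk> \<Longrightarrow>
      t x (f \<oplus>\<^bsub>N'\<^esub> g) = t x f \<otimes>\<^bsub>G\<^esub> t x g"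
    and t_smult: "\<lbrakk>a \<in> carrier R; x \<in> carrier N; f \<in> carrier N'; B f x = \<zero>\<rbrakk> \<Longrightarrow>
      t (a \<odot>\<^bsub>N\<^esub> x) f = t x (a \<odot>\<^bsub>N'\<^esub> f)"
    and t_commutator: "\<lbrakk>x \<in> carrier N; y \<in> carrier N; f \<in> carrier N'; g \<in> carrier N';
        B f x = \<zero>; B g x = \<zero>; B g y = \<zero>\<rbrakk> \<Longrightarrow>
      t x f \<otimes>\<^bsub>G\<^esub> t y g = t x (B f y \<odot>\<^bsub>N'\<^esub> g) \<otimes>\<^bsub>G\<^esub> (t y g \<otimes>\<^bsub>G\<^esub> t x f)"
begin

lemma t_zero:
  assumes "f \<in> carrier N'" shows "t \<zero>\<^bsub>N\<^esub> f = \<one>\<^bsub>G\<^esub>"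
proof -
  have 0: "B f \<zero>\<^bsub>N\<^esub> = \<zero>"
    using B_smult_right[of "\<zero>" f "\<zero>\<^bsub>N\<^esub>"] assms by simp
  have "t \<zero>\<^bsub>N\<^esub> f = t \<zero>\<^bsub>N\<^esub> f \<otimes>\<^bsub>G\<^esub> t \<zero>\<^bsub>N\<^esub> f"
    using t_add_left[of "\<zero>\<^bsub>N\<^esub>" "\<zero>\<^bsub>N\<^esub>" f] assms 0 by simp
  then show ?thesis using t_closed[of "\<zero>\<^bsub>N\<^esub>" f] assms 0 by (simp add: G.l_cancel_one')
qed

lemma t_neg:
  assumes "x \<in> carrier N" "f \<in> carrier N'" "B f x = \<zero>"
  shows "t (\<ominus>\<^bsub>N\<^esub> x) f \<otimes>\<^bsub>G\<^esub> t x f = \<one>\<^bsub>G\<^esub>"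
  using t_add_left[of "\<ominus>\<^bsub>N\<^esub> x" x f] assms by (simp add: N.M.l_neg t_zero)

lemma t_neg_swap:
  assumes "x \<in> carrier N" "f \<in> carrier N'" "B f x = \<zero>"
  shows "t (\<ominus>\<^bsub>N\<^esub> x) f = t x (\<ominus>\<^bsub>N'\<^esub> f)"
  using t_smult[of "\<ominus> \<one>" x f] assms by (simp add: N.smult_l_minus N'.smult_l_minus)

text \<open>
  Exchanging the modules inverts the commutators, so a sign has to be put into one of the arguments.
\<close>

lemma swap: "transvection_system R N' N (\<lambda>x f. B f x) G (\<lambda>f x. t (\<ominus>\<^bsub>N\<^esub> x) f)"
proof unfold_locales
  fix f g x y assume a: "f \<in> carrier N'" "g \<in> carrier N'" "x \<in> carrier N" "y \<in> carrier N"
    "B f x = \<zero>" "B f y = \<zero>" "B g y = \<zero>"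
  define nx ny where "nx = \<ominus>\<^bsub>N\<^esub> x" "ny = \<ominus>\<^bsub>N\<^esub> y"
  have n: "nx \<in> carrier N" "ny \<in> carrier N" "B f nx = \<zero>" "B f ny = \<zero>" "B g ny = \<zero>"
    using a by (simp_all add: nx_ny_def)
  let ?k = "t ny (B g nx \<odot>\<^bsub>N'\<^esub> f)"
  have k: "?k \<in> carrier G" using n a by (intro t_closed) auto
  have c: "t ny g \<otimes>\<^bsub>G\<^esub> t nx f = ?k \<otimes>\<^bsub>G\<^esub> (t nx f \<otimes>\<^bsub>G\<^esub> t ny g)"
    using t_commutator[of ny nx g f] n a by simp
  have e1: "\<ominus>\<^bsub>N\<^esub> (B g x \<odot>\<^bsub>N\<^esub> y) = \<ominus>\<^bsub>N\<^esub> (B g nx \<odot>\<^bsub>N\<^esub> ny)"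
    using a by (simp add: nx_ny_def N.smult_l_minus N.smult_r_minus)
  have "t (\<ominus>\<^bsub>N\<^esub> (B g nx \<odot>\<^bsub>N\<^esub> ny)) f \<otimes>\<^bsub>G\<^esub> t (B g nx \<odot>\<^bsub>N\<^esub> ny) f = \<one>\<^bsub>G\<^esub>"
    using n a by (intro t_neg) auto
  then have inv: "t (\<ominus>\<^bsub>N\<^esub> (B g x \<odot>\<^bsub>N\<^esub> y)) f \<otimes>\<^bsub>G\<^esub> ?k = \<one>\<^bsub>G\<^esub>"
    using n a by (simp add: e1 t_smult)
  have cl: "t (\<ominus>\<^bsub>N\<^esub> (B g x \<odot>\<^bsub>N\<^esub> y)) f \<in> carrier G" "t nx f \<in> carrier G" "t ny g \<in> carrier G"
    using n a by (auto intro!: t_closed)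
  have "t (\<ominus>\<^bsub>N\<^esub> (B g x \<odot>\<^bsub>N\<^esub> y)) f \<otimes>\<^bsub>G\<^esub> (t ny g \<otimes>\<^bsub>G\<^esub> t nx f) = t nx f \<otimes>\<^bsub>G\<^esub> t ny g"
    unfolding c using cl k inv by (simp add: G.m_assoc[symmetric])
  then show "t (\<ominus>\<^bsub>N\<^esub> x) f \<otimes>\<^bsub>G\<^esub> t (\<ominus>\<^bsub>N\<^esub> y) g
      = t (\<ominus>\<^bsub>N\<^esub> (B g x \<odot>\<^bsub>N\<^esub> y)) f \<otimes>\<^bsub>G\<^esub> (t (\<ominus>\<^bsub>N\<^esub> y) g \<otimes>\<^bsub>G\<^esub> t (\<ominus>\<^bsub>N\<^esub> x) f)"
    by (simp add: nx_ny_def)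
next
  fix a f x assume *: "a \<in> carrier R" "f \<in> carrier N'" "x \<in> carrier N" "B f x = \<zero>"
  then show "t (\<ominus>\<^bsub>N\<^esub> x) (a \<odot>\<^bsub>N'\<^esub> f) = t (\<ominus>\<^bsub>N\<^esub> (a \<odot>\<^bsub>N\<^esub> x)) f"
    using t_smult[of a "\<ominus>\<^bsub>N\<^esub> x" f] by (simp add: N.smult_r_minus)
qed (auto simp: t_closed t_add_right t_add_left N.minus_add)

end


text \<open>
  The vectors \<open>e\<close> and \<open>e'\<close> split off a free summand of rank one from \<open>N\<close> and \<open>N'\<close>. The submodules \<open>J\<close>
  and \<open>J'\<close> play the parts of \<open>IN\<close> and \<open>IN\<^sup>*\<close>; of the ideal only the four compatibilities below matter.
  \<open>E\<close> and \<open>H\<close> stand for the elementary group and for a subgroup normalized by it.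
\<close>

locale elementary_pair = transvection_system R N N' B G t
  for R :: "('a, 'k) ring_scheme" (structure)
    and N :: "('a, 'n, 'i) module_scheme" and N' :: "('a, 'p, 'j) module_scheme" and B
    and G :: "('g, 'l) monoid_scheme" and t +
  fixes e e' J J' E H
  assumes e [simp]: "e \<in> carrier N" and e' [simp]: "e' \<in> carrier N'"
    and B_e [simp]: "B e' e = \<one>"
    and J: "submodule J R N" and J': "submodule J' R N'"
    and J_J: "\<lbrakk>x \<in> J; f \<in> carrier N'; y \<in> carrier N\<rbrakk> \<Longrightarrow> B f x \<odot>\<^bsub>N\<^esub> y \<in> J"
    and J_J': "\<lbrakk>x \<in> J; f \<in> carrier N'; g \<in> carrier N'\<rbrakk> \<Longrightarrow> B f x \<odot>\<^bsub>N'\<^esub> g \<in> J'"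
    and J'_J: "\<lbrakk>f \<in> J'; x \<in> carrier N; y \<in> carrier N\<rbrakk> \<Longrightarrow> B f x \<odot>\<^bsub>N\<^esub> y \<in> J"
    and J'_J': "\<lbrakk>f \<in> J'; x \<in> carrier N; g \<in> carrier N'\<rbrakk> \<Longrightarrow> B f x \<odot>\<^bsub>N'\<^esub> g \<in> J'"
    and E: "subgroup E G" and H: "subgroup H G"
    and conj: "\<lbrakk>k \<in> E; h \<in> H\<rbrakk> \<Longrightarrow> k \<otimes>\<^bsub>G\<^esub> h \<otimes>\<^bsub>G\<^esub> inv\<^bsub>G\<^esub> k \<in> H"
    and E_left: "\<lbrakk>x \<in> carrier N; B e' x = \<zero>\<rbrakk> \<Longrightarrow> t x e' \<in> E"
    and E_right: "\<lbrakk>f \<in> carrier N'; B f e = \<zero>\<rbrakk> \<Longrightarrow> t e f \<in> E"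
    and H_left: "\<lbrakk>x \<in> J; B e' x = \<zero>\<rbrakk> \<Longrightarrow> t x e' \<in> H"
    and H_right: "\<lbrakk>f \<in> J'; B f e = \<zero>\<rbrakk> \<Longrightarrow> t e f \<in> H"
begin

lemma swap_pair:
  "elementary_pair R N' N (\<lambda>x f. B f x) G (\<lambda>f x. t (\<ominus>\<^bsub>N\<^esub> x) f) e' e J' J E H"
proof -
  note sub = N.submoduleE[OF J] N'.submoduleE[OF J']
  have neg: "t (\<ominus>\<^bsub>N\<^esub> e) f = t e (\<ominus>\<^bsub>N'\<^esub> f)" if "f \<in> carrier N'" "B f e = \<zero>" for f
    using that by (simp add: t_neg_swap)
  show ?thesis
  proof (intro elementary_pair.intro elementary_pair_axioms.intro)
    fix f assume f: "f \<in> carrier N'" "B f e = \<zero>"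
    then show "t (\<ominus>\<^bsub>N\<^esub> e) f \<in> E" using E_right[of "\<ominus>\<^bsub>N'\<^esub> f"] by (simp add: neg)
  next
    fix f assume f: "f \<in> J'" "B f e = \<zero>"
    then have "f \<in> carrier N'" using sub(7) by blast
    then show "t (\<ominus>\<^bsub>N\<^esub> e) f \<in> H" using f H_right[of "\<ominus>\<^bsub>N'\<^esub> f"] sub(9) by (simp add: neg)
  next
    fix x assume x: "x \<in> J" "B e' x = \<zero>"
    then have "x \<in> carrier N" using sub(1) by blast
    then show "t (\<ominus>\<^bsub>N\<^esub> x) e' \<in> H" using x H_left[of "\<ominus>\<^bsub>N\<^esub> x"] sub(3) by simp
  next
    fix x assume x: "x \<in> carrier N" "B e' x = \<zero>"
    then show "t (\<ominus>\<^bsub>N\<^esub> x) e' \<in> E" using E_left[of "\<ominus>\<^bsub>N\<^esub> x"] by simp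
  qed (fact swap e e' B_e J J' J_J J_J' J'_J J'_J' E H conj)+
qed

lemma J'_closed:
  assumes "f \<in> J'"
  shows "f \<in> carrier N'" and "a \<in> carrier R \<Longrightarrow> a \<odot>\<^bsub>N'\<^esub> f \<in> J'"
    and "g \<in> J' \<Longrightarrow> f \<oplus>\<^bsub>N'\<^esub> g \<in> J'" and "g \<in> J' \<Longrightarrow> f \<ominus>\<^bsub>N'\<^esub> g \<in> J'"
  using N'.submoduleE[OF J'] assms by (auto simp: a_minus_def)

lemma H_commutator:
  assumes "g \<in> E" "h \<in> H" "k \<in> carrier G" "g \<otimes>\<^bsub>G\<^esub> h = k \<otimes>\<^bsub>G\<^esub> (h \<otimes>\<^bsub>G\<^esub> g)"
  shows "k \<in> H"
proof -
  have gh: "g \<in> carrier G" "h \<in> carrier G"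
    using assms subgroup.subset[OF E] subgroup.subset[OF H] by auto
  have "k \<otimes>\<^bsub>G\<^esub> h \<otimes>\<^bsub>G\<^esub> g = g \<otimes>\<^bsub>G\<^esub> h"
    using assms(3,4) gh by (simp add: G.m_assoc)
  then have "k = (g \<otimes>\<^bsub>G\<^esub> h \<otimes>\<^bsub>G\<^esub> inv\<^bsub>G\<^esub> g) \<otimes>\<^bsub>G\<^esub> inv\<^bsub>G\<^esub> h"
    using assms(3) gh by (metis G.inv_closed G.inv_solve_right G.m_closed)
  also have "\<dots> \<in> H"
    using conj[OF assms(1,2)] assms(2) H by (meson subgroup.m_closed subgroup.m_inv_closed)
  finally show ?thesis .
qed

text \<open>
  Split \<open>w\<close> as \<open>b e' + f\<close>, where \<open>f\<close> kills \<open>e\<close>. The first summand gives the generator \<open>t (b z) e'\<close>, and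
  the second a commutator of \<open>t z e'\<close> with the generator \<open>t e f\<close>.
\<close>

lemma t_mem_H_left:
  assumes z: "z \<in> carrier N" "B e' z = \<zero>" and w: "w \<in> J'" "B w z = \<zero>"
  shows "t z w \<in> H"
proof -
  have wc: "w \<in> carrier N'" using w J'_closed by blast
  define b where "b = B w e"
  define f where "f = w \<ominus>\<^bsub>N'\<^esub> b \<odot>\<^bsub>N'\<^esub> e'"
  have b: "b \<in> carrier R" "b \<odot>\<^bsub>N\<^esub> z \<in> J" "b \<odot>\<^bsub>N'\<^esub> e' \<in> J'"
    using w z wc J'_J J'_J' by (auto simp: b_def)
  have f: "f \<in> J'" "f \<in> carrier N'" "B f e = \<zero>" "B f z = \<zero>"
    using w z wc b J'_closed by (auto simp: f_def b_def R.r_right_minus_eq)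
  have "b \<odot>\<^bsub>N'\<^esub> e' \<oplus>\<^bsub>N'\<^esub> f = w"
    using wc b(1) by (simp add: f_def a_minus_def N'.M.a_lcomm N'.M.r_neg)
  moreover have "t z (b \<odot>\<^bsub>N'\<^esub> e') \<in> H"
    using t_smult[of b z e'] b z by (auto intro!: H_left simp flip: t_smult)
  moreover have "t z f \<in> H"
  proof (rule H_commutator)
    show "t z e' \<otimes>\<^bsub>G\<^esub> t e f = t z f \<otimes>\<^bsub>G\<^esub> (t e f \<otimes>\<^bsub>G\<^esub> t z e')"
      using t_commutator[of z e e' f] z f by simp
  qed (use z f in \<open>auto intro: E_left H_right t_closed\<close>)
  ultimately show ?thesis
    using t_add_right[of z "b \<odot>\<^bsub>N'\<^esub> e'" f] z f b H by (auto intro: subgroup.m_closed)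
qed

text \<open>
  Split \<open>v\<close> as \<open>a e + m\<close> with \<open>m\<close> killed by \<open>e'\<close>, which is the case just treated.
\<close>

lemma t_mem_H_right:
  assumes v: "v \<in> carrier N" and f: "f \<in> J'" "B f e = \<zero>" "B f v = \<zero>"
  shows "t v f \<in> H"
proof -
  have fc: "f \<in> carrier N'" using f J'_closed by blast
  define a where "a = B e' v"
  define m where "m = v \<ominus>\<^bsub>N\<^esub> a \<odot>\<^bsub>N\<^esub> e"
  have a: "a \<in> carrier R" using v by (simp add: a_def)
  have m: "m \<in> carrier N" "B e' m = \<zero>" "B f m = \<zero>"
    using v f fc a by (auto simp: m_def a_def R.r_right_minus_eq)
  have "a \<odot>\<^bsub>N\<^esub> e \<oplus>\<^bsub>N\<^esub> m = v"
    using v a by (simp add: m_def a_minus_def N.M.a_lcomm N.M.r_neg)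
  moreover have "t (a \<odot>\<^bsub>N\<^esub> e) f \<in> H"
    using a f fc by (simp add: t_smult H_right J'_closed)
  moreover have "t m f \<in> H" using m f by (intro t_mem_H_left) auto
  ultimately show ?thesis
    using t_add_left[of "a \<odot>\<^bsub>N\<^esub> e" m f] a m f fc H by (auto intro: subgroup.m_closed)
qed

text \<open>
  The unrelativized statement is the special case in which \<open>J\<close> and \<open>J'\<close> are everything and \<open>H = E\<close>.
\<close>

lemma t_mem_E_right:
  assumes "v \<in> carrier N" "f \<in> carrier N'" "B f e = \<zero>" "B f v = \<zero>"
  shows "t v f \<in> E"
proof -
  interpret E: elementary_pair R N N' B G t e e' "carrier N" "carrier N'" E E
  proof (intro elementary_pair.intro elementary_pair_axioms.intro)
    fix k h assume "k \<in> E" "h \<in> E"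
    then show "k \<otimes>\<^bsub>G\<^esub> h \<otimes>\<^bsub>G\<^esub> inv\<^bsub>G\<^esub> k \<in> E"
      using E by (simp add: subgroup.m_closed subgroup.m_inv_closed)
  qed (use transvection_system_axioms E in
      \<open>simp_all add: N.carrier_is_submodule N'.carrier_is_submodule E_left E_right\<close>)
  show ?thesis using assms by (rule E.t_mem_H_right)
qed

text \<open>
  The vector \<open>v = c q - (B s q) z\<close>, with \<open>c = B s z\<close>, is killed by both \<open>s\<close> and \<open>w\<close>, so the commutator of
  \<open>t v s\<close> with \<open>t z w\<close> is \<open>t v (c w)\<close>. One factor \<open>c\<close> comes from this commutator, the other from the
  replacement of \<open>q\<close> by \<open>c q\<close>.
\<close>

lemma t_square_mem_H:
  assumes q: "q \<in> carrier N" and w: "w \<in> J'" "B w q = \<zero>"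
    and z: "z \<in> carrier N" "B e' z = \<zero>" "B w z = \<zero>"
    and s: "s \<in> carrier N'" "B s e = \<zero>"
  shows "t q ((B s z \<otimes> B s z) \<odot>\<^bsub>N'\<^esub> w) \<in> H"
proof -
  have wc: "w \<in> carrier N'" using w J'_closed by blast
  define c where "c = B s z"
  define v where "v = c \<odot>\<^bsub>N\<^esub> q \<ominus>\<^bsub>N\<^esub> B s q \<odot>\<^bsub>N\<^esub> z"
  have c: "c \<in> carrier R" "B s q \<in> carrier R" using s z q by (auto simp: c_def)
  have v: "v \<in> carrier N" "B s v = \<zero>" "B w v = \<zero>"
    using q w z s wc c by (auto simp: v_def c_def R.r_right_minus_eq R.m_comm)
  have cw: "c \<odot>\<^bsub>N'\<^esub> w \<in> J'" "c \<odot>\<^bsub>N'\<^esub> w \<in> carrier N'" using c w wc J'_closed by auto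
  have "t v (c \<odot>\<^bsub>N'\<^esub> w) \<in> H"
  proof (rule H_commutator)
    show "t v s \<otimes>\<^bsub>G\<^esub> t z w = t v (c \<odot>\<^bsub>N'\<^esub> w) \<otimes>\<^bsub>G\<^esub> (t z w \<otimes>\<^bsub>G\<^esub> t v s)"
      unfolding c_def using v z s wc by (intro t_commutator) auto
    show "t v s \<in> E" using v s by (intro t_mem_E_right)
    show "t z w \<in> H" using z w by (intro t_mem_H_left)
  qed (use v wc c in \<open>auto intro!: t_closed\<close>)
  moreover have "t (B s q \<odot>\<^bsub>N\<^esub> z) (c \<odot>\<^bsub>N'\<^esub> w) \<in> H"
    using c z cw wc by (intro t_mem_H_left) auto
  moreover have "v \<oplus>\<^bsub>N\<^esub> B s q \<odot>\<^bsub>N\<^esub> z = c \<odot>\<^bsub>N\<^esub> q"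
    using q z c by (simp add: v_def a_minus_def N.M.a_assoc N.M.l_neg)
  ultimately have "t (c \<odot>\<^bsub>N\<^esub> q) (c \<odot>\<^bsub>N'\<^esub> w) \<in> H"
    using t_add_left[of v "B s q \<odot>\<^bsub>N\<^esub> z" "c \<odot>\<^bsub>N'\<^esub> w"] v c z wc H by (auto intro: subgroup.m_closed)
  then show ?thesis
    using q c w wc by (simp add: t_smult N'.smult_assoc1 flip: c_def)
qed

text \<open>
  The functional \<open>w\<close> is the contraction of \<open>e' \<and> f\<close> with \<open>q\<close>. Here rank two enters: for rank one the
  statement would be about \<open>SL\<^sub>2\<close>, where it can fail. The minors are tested one prime at a time, which avoids
  writing \<open>\<one>\<close> as a combination of them.
\<close>

lemma t_hyperbolic_mem_H:
  assumes q: "q \<in> carrier N" and f: "f \<in> J'" "B f e = \<zero>"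
    and w_def: "w = B e' q \<odot>\<^bsub>N'\<^esub> f \<ominus>\<^bsub>N'\<^esub> B f q \<odot>\<^bsub>N'\<^esub> e'"
    and minors: "\<And>P. primeideal P R \<Longrightarrow> \<exists>x\<in>carrier N. \<exists>y\<in>carrier N. \<exists>r\<in>carrier N'. \<exists>s\<in>carrier N'.
      B e' x = \<zero> \<and> B e' y = \<zero> \<and> B r e = \<zero> \<and> B s e = \<zero> \<and>
      B r x \<otimes> B s y \<ominus> B r y \<otimes> B s x \<notin> P"
  shows "t q w \<in> H"
proof -
  define a where "a = B e' q"
  have fc: "f \<in> carrier N'" using f J'_closed by blast
  have a: "a \<in> carrier R" using q by (simp add: a_def)
  have w: "w \<in> J'" "B w q = \<zero>" "w \<in> carrier N'"
    using q f fc J'_J'[of f q e'] unfolding w_def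
    by (auto simp: R.r_right_minus_eq R.m_comm J'_closed)
  \<comment> \<open>the quantifier over \<open>r\<close> makes this set an ideal for trivial reasons\<close>
  define A where "A = {d \<in> carrier R. \<forall>r\<in>carrier R. t q ((r \<otimes> d) \<odot>\<^bsub>N'\<^esub> w) \<in> H}"
  have "\<one> \<in> A"
  proof (rule ccontr)
    assume "\<one> \<notin> A"
    moreover have "ideal A R"
    proof (rule idealI)
      show "ring R" by unfold_locales
      have "\<zero> \<in> A"
        using t_smult[of \<zero> q w] q w t_zero subgroup.one_closed[OF H] by (auto simp: A_def)
      moreover have "\<ominus> d \<in> A" if "d \<in> A" for d
      proof -
        have "t q ((r \<otimes> \<ominus> d) \<odot>\<^bsub>N'\<^esub> w) \<in> H" if "r \<in> carrier R" for r
        proof -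
          have "r \<otimes> \<ominus> d = \<ominus> r \<otimes> d" using \<open>d \<in> A\<close> that by (simp add: A_def R.r_minus R.l_minus)
          then show ?thesis using \<open>d \<in> A\<close> that by (simp add: A_def)
        qed
        then show ?thesis using that by (simp add: A_def)
      qed
      moreover have "d \<oplus> d' \<in> A" if "d \<in> A" "d' \<in> A" for d d'
        using that w q H by (auto simp: A_def R.r_distr N'.smult_l_distr t_add_right intro!: subgroup.m_closed)
      ultimately show "subgroup A (add_monoid R)"
        by (auto intro!: subgroup.intro simp: a_inv_def[symmetric]) (auto simp: A_def)
      fix d x assume d: "d \<in> A" "x \<in> carrier R"
      show "x \<otimes> d \<in> A" using d by (auto simp: A_def simp flip: R.m_assoc)
      then show "d \<otimes> x \<in> A" using d R.m_comm[of d x] by (simp add: A_def)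
    qed
    ultimately obtain P where P: "primeideal P R" "A \<subseteq> P"
      using R.ex_primeideal_containing by blast
    interpret P: primeideal P R by (rule P)
    obtain x y r s where xy: "x \<in> carrier N" "y \<in> carrier N" "B e' x = \<zero>" "B e' y = \<zero>"
      and rs: "r \<in> carrier N'" "s \<in> carrier N'" "B r e = \<zero>" "B s e = \<zero>"
      and notP: "B r x \<otimes> B s y \<ominus> B r y \<otimes> B s x \<notin> P"
      using minors[OF P(1)] by blast
    define c where "c = B r x \<otimes> B s y \<ominus> B r y \<otimes> B s x"
    \<comment> \<open>by Cramer's rule \<open>B s z = c = B r z'\<close>, whereas \<open>B s z' = \<zero>\<close>\<close>
    define z where "z = B r x \<odot>\<^bsub>N\<^esub> y \<ominus>\<^bsub>N\<^esub> B r y \<odot>\<^bsub>N\<^esub> x"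
    define z' where "z' = B s y \<odot>\<^bsub>N\<^esub> x \<ominus>\<^bsub>N\<^esub> B s x \<odot>\<^bsub>N\<^esub> y"
    have c: "c \<in> carrier R" using xy rs by (simp add: c_def)
    have z: "z \<in> carrier N" "z' \<in> carrier N" "B e' z = \<zero>" "B e' z' = \<zero>"
      "B s z = c" "B s z' = \<zero>" "B r z' = c"
      using xy rs by (auto simp: z_def z'_def c_def R.r_right_minus_eq R.m_comm)
    \<comment> \<open>the functional \<open>u\<close> is to \<open>s\<close> what \<open>w\<close> is to \<open>f\<close>; subtracting a multiple of it makes \<open>c w\<close> vanish at \<open>z\<close>, and \<open>u\<close> itself vanishes at \<open>z'\<close>\<close>
    define u where "u = a \<odot>\<^bsub>N'\<^esub> s \<ominus>\<^bsub>N'\<^esub> B s q \<odot>\<^bsub>N'\<^esub> e'"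
    define w2 where "w2 = B f z \<odot>\<^bsub>N'\<^esub> u"
    define w1 where "w1 = c \<odot>\<^bsub>N'\<^esub> w \<ominus>\<^bsub>N'\<^esub> w2"
    have u: "u \<in> carrier N'" "B u q = \<zero>" "B u z = a \<otimes> c" "B u z' = \<zero>"
      using rs q a z by (auto simp: u_def a_def R.m_comm R.minus_eq R.r_neg)
    have fz: "B f z \<in> carrier R" using fc z by simp
    have w2: "w2 \<in> J'" "B w2 q = \<zero>" "B w2 z' = \<zero>" "w2 \<in> carrier N'"
      using u z q f fc fz J'_J' J'_closed by (auto simp: w2_def)
    have wz: "B w z = a \<otimes> B f z"
      using q fc z fz by (simp add: w_def a_def R.minus_eq)
    have w1: "w1 \<in> J'" "B w1 q = \<zero>" "B w1 z = \<zero>" "w1 \<in> carrier N'"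
    proof -
      have "c \<otimes> (a \<otimes> B f z) = B f z \<otimes> (a \<otimes> c)"
        using a c fz by (simp add: R.m_ac)
      then show "B w1 z = \<zero>"
        using w w2 z q c u fz a by (simp add: w1_def w2_def wz R.r_right_minus_eq)
    qed (use w w2 z q c in \<open>auto simp: w1_def J'_closed R.r_right_minus_eq\<close>)
    have cw: "c \<odot>\<^bsub>N'\<^esub> w = w1 \<oplus>\<^bsub>N'\<^esub> w2"
      using w w2 c by (simp add: w1_def a_minus_def N'.M.a_assoc N'.M.l_neg)
    have "c \<otimes> (c \<otimes> c) \<in> A"
    proof -
      have "t q ((d \<otimes> (c \<otimes> (c \<otimes> c))) \<odot>\<^bsub>N'\<^esub> w) \<in> H" if d: "d \<in> carrier R" for d
      proof -
        have "t q ((c \<otimes> c) \<odot>\<^bsub>N'\<^esub> (d \<odot>\<^bsub>N'\<^esub> w1)) \<in> H"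
          using t_square_mem_H[of q "d \<odot>\<^bsub>N'\<^esub> w1" z s] d w1 q z rs by (simp add: J'_closed)
        moreover have "t q ((c \<otimes> c) \<odot>\<^bsub>N'\<^esub> (d \<odot>\<^bsub>N'\<^esub> w2)) \<in> H"
          using t_square_mem_H[of q "d \<odot>\<^bsub>N'\<^esub> w2" z' r] d w2 q z rs by (simp add: J'_closed)
        moreover have "(d \<otimes> (c \<otimes> (c \<otimes> c))) \<odot>\<^bsub>N'\<^esub> w = ((c \<otimes> c) \<otimes> d) \<odot>\<^bsub>N'\<^esub> (c \<odot>\<^bsub>N'\<^esub> w)"
          using d c w by (simp add: N'.smult_assoc1[symmetric] R.m_ac)
        ultimately show ?thesis
          unfolding cw using d c w1 w2 q H
          by (simp add: N'.smult_r_distr N'.smult_assoc1 t_add_right subgroup.m_closed)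
      qed
      then show ?thesis using c by (simp add: A_def)
    qed
    then have "c \<otimes> (c \<otimes> c) \<in> P" using P(2) by blast
    then have "c \<in> P" using P.I_prime c by blast
    then show False using notP by (simp add: c_def)
  qed
  then show ?thesis using w by (auto simp: A_def dest!: bspec[of _ _ \<one>])
qed

text \<open>
  Choose \<open>f = g(e) p - p(e) g\<close>, the contraction of \<open>g \<and> p\<close> with \<open>e\<close>. Since \<open>g(q) = \<one>\<close> and
  \<open>p(q) = \<zero>\<close>, it satisfies \<open>f(q) = -p(e)\<close>. Therefore the functional \<open>w\<close> attached to it takes the value
  \<open>p(e)\<close> at \<open>e\<close>, and \<open>p - w\<close> kills both \<open>e\<close> and \<open>q\<close>.
\<close>

lemma t_unimodular_mem_H:
  assumes q: "q \<in> carrier N" "g \<in> carrier N'" "B g q = \<one>"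
    and p: "p \<in> J'" "B p q = \<zero>"
    and minors: "\<And>P. primeideal P R \<Longrightarrow> \<exists>x\<in>carrier N. \<exists>y\<in>carrier N. \<exists>r\<in>carrier N'. \<exists>s\<in>carrier N'.
      B e' x = \<zero> \<and> B e' y = \<zero> \<and> B r e = \<zero> \<and> B s e = \<zero> \<and>
      B r x \<otimes> B s y \<ominus> B r y \<otimes> B s x \<notin> P"
  shows "t q p \<in> H"
proof -
  have pc: "p \<in> carrier N'" using p J'_closed by blast
  define f where "f = B g e \<odot>\<^bsub>N'\<^esub> p \<ominus>\<^bsub>N'\<^esub> B p e \<odot>\<^bsub>N'\<^esub> g"
  have f: "f \<in> J'" "B f e = \<zero>" "B f q = \<ominus> B p e" "f \<in> carrier N'"
    using q p pc J'_J'[of p e g]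
    by (auto simp: f_def J'_closed R.m_comm R.minus_eq R.r_neg)
  define w where "w = B e' q \<odot>\<^bsub>N'\<^esub> f \<ominus>\<^bsub>N'\<^esub> B f q \<odot>\<^bsub>N'\<^esub> e'"
  have w: "w \<in> J'" "B w q = \<zero>" "B w e = B p e" "w \<in> carrier N'"
    using q f pc J'_J'[of f q e'] unfolding w_def
    by (auto simp: R.r_right_minus_eq R.m_comm J'_closed) (auto simp: R.minus_eq)
  have "t q w \<in> H"
    using q f w_def minors by (intro t_hyperbolic_mem_H)
  moreover have "t q (p \<ominus>\<^bsub>N'\<^esub> w) \<in> H"
    using q p w pc by (intro t_mem_H_right) (auto simp: J'_closed R.r_right_minus_eq)
  moreover have "w \<oplus>\<^bsub>N'\<^esub> (p \<ominus>\<^bsub>N'\<^esub> w) = p"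
    using w pc by (simp add: a_minus_def N'.M.a_lcomm N'.M.r_neg)
  ultimately show ?thesis
    using t_add_right[of q w "p \<ominus>\<^bsub>N'\<^esub> w"] q w p pc H
    by (auto intro: subgroup.m_closed simp: R.r_right_minus_eq)
qed

end

section \<open>Modules, homomorphisms and duals\<close>

lemma reg_module_simps [simp]:
  "carrier (reg_module R) = carrier R" "\<zero>\<^bsub>reg_module R\<^esub> = \<zero>\<^bsub>R\<^esub>"
  "x \<oplus>\<^bsub>reg_module R\<^esub> y = x \<oplus>\<^bsub>R\<^esub> y" "a \<odot>\<^bsub>reg_module R\<^esub> x = a \<otimes>\<^bsub>R\<^esub> x"
  by (simp_all add: reg_module_def)

lemma direct_sum_simps [simp]:
  "carrier (direct_sum M N) = carrier M \<times> carrier N"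
  "\<zero>\<^bsub>direct_sum M N\<^esub> = (\<zero>\<^bsub>M\<^esub>, \<zero>\<^bsub>N\<^esub>)"
  "(x, y) \<oplus>\<^bsub>direct_sum M N\<^esub> (x', y') = (x \<oplus>\<^bsub>M\<^esub> x', y \<oplus>\<^bsub>N\<^esub> y')"
  "a \<odot>\<^bsub>direct_sum M N\<^esub> (x, y) = (a \<odot>\<^bsub>M\<^esub> x, a \<odot>\<^bsub>N\<^esub> y)"
  by (simp_all add: direct_sum_def)

lemma module_reg_module: "cring R \<Longrightarrow> module R (reg_module R)"
proof -
  assume "cring R"
  then interpret cring R .
  show ?thesis
  proof (intro moduleI abelian_groupI)
    fix x assume "x \<in> carrier (reg_module R)"
    then show "\<exists>y\<in>carrier (reg_module R). y \<oplus>\<^bsub>reg_module R\<^esub> x = \<zero>\<^bsub>reg_module R\<^esub>"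
      by (auto intro!: bexI[of _ "\<ominus>\<^bsub>R\<^esub> x"] simp: l_neg)
  qed (auto simp: a_ac m_ac l_distr r_distr is_cring)
qed

lemma module_direct_sum:
  assumes "module R M" "module R N"
  shows "module R (direct_sum M N)"
proof -
  interpret M: module R M by fact
  interpret N: module R N by fact
  show ?thesis
  proof (intro moduleI abelian_groupI)
    fix x assume "x \<in> carrier (direct_sum M N)"
    then show "\<exists>y\<in>carrier (direct_sum M N). y \<oplus>\<^bsub>direct_sum M N\<^esub> x = \<zero>\<^bsub>direct_sum M N\<^esub>"
      by (auto intro!: bexI[of _ "(\<ominus>\<^bsub>M\<^esub> fst x, \<ominus>\<^bsub>N\<^esub> snd x)"] simp: M.M.l_neg N.M.l_neg)
  qed (auto simp: M.M.a_ac N.M.a_ac M.R.is_cring M.smult_l_distr N.smult_l_distr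
      M.smult_r_distr N.smult_r_distr M.smult_assoc1 N.smult_assoc1)
qed

lemma mod_hom_iff:
  "f \<in> mod_hom R M N \<longleftrightarrow> (\<forall>x\<in>carrier M. f x \<in> carrier N) \<and>
     (\<forall>x\<in>carrier M. \<forall>y\<in>carrier M. f (x \<oplus>\<^bsub>M\<^esub> y) = f x \<oplus>\<^bsub>N\<^esub> f y) \<and>
     (\<forall>a\<in>carrier R. \<forall>x\<in>carrier M. f (a \<odot>\<^bsub>M\<^esub> x) = a \<odot>\<^bsub>N\<^esub> f x)"
  by (auto simp: mod_hom_def hom_def)

lemma mod_homD:
  assumes "f \<in> mod_hom R M N" "x \<in> carrier M"
  shows "f x \<in> carrier N"
    and "y \<in> carrier M \<Longrightarrow> f (x \<oplus>\<^bsub>M\<^esub> y) = f x \<oplus>\<^bsub>N\<^esub> f y"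
    and "a \<in> carrier R \<Longrightarrow> f (a \<odot>\<^bsub>M\<^esub> x) = a \<odot>\<^bsub>N\<^esub> f x"
  using assms by (auto simp: mod_hom_iff)

lemma mod_hom_zero:
  assumes "module R M" "module R N" "f \<in> mod_hom R M N"
  shows "f \<zero>\<^bsub>M\<^esub> = \<zero>\<^bsub>N\<^esub>"
proof -
  interpret M: module R M by fact
  interpret N: module R N by fact
  show ?thesis
    using mod_homD(3)[OF assms(3), of "\<zero>\<^bsub>M\<^esub>" "\<zero>\<^bsub>R\<^esub>"] mod_homD(1)[OF assms(3)] by simp
qed

lemma mod_hom_neg:
  assumes "module R M" "module R N" "f \<in> mod_hom R M N" "x \<in> carrier M"
  shows "f (\<ominus>\<^bsub>M\<^esub> x) = \<ominus>\<^bsub>N\<^esub> f x"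
proof -
  interpret M: module R M by fact
  interpret N: module R N by fact
  show ?thesis
    using mod_homD(3)[OF assms(3,4), of "\<ominus>\<^bsub>R\<^esub> \<one>\<^bsub>R\<^esub>"] mod_homD(1)[OF assms(3,4)] assms(4)
    by (simp add: M.smult_l_minus N.smult_l_minus)
qed

lemma mod_hom_finsum:
  assumes "module R M" "module R N" "f \<in> mod_hom R M N" "finite A" "g \<in> A \<rightarrow> carrier M"
  shows "f (\<Oplus>\<^bsub>M\<^esub>i\<in>A. g i) = (\<Oplus>\<^bsub>N\<^esub>i\<in>A. f (g i))"
proof -
  interpret M: module R M by fact
  interpret N: module R N by fact
  show ?thesis
    using assms(4,5)
    by (induction A rule: finite_induct)
      (auto simp: mod_hom_zero[OF assms(1-3)] mod_homD[OF assms(3)] Pi_iff)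
qed

lemma submodule_vimage:
  assumes "module R M" "module R N" "f \<in> mod_hom R M N" "submodule K R N"
  shows "submodule {x \<in> carrier M. f x \<in> K} R M"
proof -
  interpret M: module R M by fact
  interpret N: module R N by fact
  note K = N.submoduleE[OF assms(4)]
  have "\<zero>\<^bsub>N\<^esub> \<in> K"
    using subgroup.one_closed[OF submodule.axioms(1)[OF assms(4)]] by simp
  then show ?thesis
    using K by (intro M.submoduleI)
      (auto simp: mod_hom_zero[OF assms(1-3)] mod_hom_neg[OF assms(1-3)] mod_homD[OF assms(3)])
qed

lemma ideal_imp_submodule:
  assumes "cring R" "ideal I R"
  shows "submodule I R (reg_module R)"
proof -
  interpret cring R by fact
  interpret I: ideal I R by fact
  interpret reg: module R "reg_module R" by (rule module_reg_module) fact
  have "\<ominus>\<^bsub>reg_module R\<^esub> a = \<ominus>\<^bsub>R\<^esub> a" if "a \<in> carrier R" for a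
    using reg.smult_l_minus[of "\<one>\<^bsub>R\<^esub>" a] that l_minus[of "\<one>\<^bsub>R\<^esub>" a] by simp
  then show ?thesis
    by (intro reg.submoduleI) (auto simp: I.I_l_closed I.a_subset subsetD[OF I.a_subset])
qed

lemma mod_span_minimal: "submodule K R M \<Longrightarrow> B \<subseteq> K \<Longrightarrow> mod_span R M B \<subseteq> K"
  by (auto simp: mod_span_def)

lemma submodule_mod_span:
  assumes "module R M" "B \<subseteq> carrier M"
  shows "submodule (mod_span R M B) R M"
proof -
  interpret M: module R M by fact
  have zero: "\<zero>\<^bsub>M\<^esub> \<in> K" if "submodule K R M" for K
    using subgroup.one_closed[OF submodule.axioms(1)[OF that]] by simp
  show ?thesis
    using M.carrier_is_submodule assms(2)
    by (intro M.submoduleI) (auto simp: mod_span_def zero M.submoduleE)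
qed

lemma ideal_smult_smult: "i \<in> I \<Longrightarrow> x \<in> carrier M \<Longrightarrow> i \<odot>\<^bsub>M\<^esub> x \<in> ideal_smult R I M"
  by (auto simp: ideal_smult_def mod_span_def)

lemma submodule_ideal_smult:
  assumes "module R M" "ideal I R"
  shows "submodule (ideal_smult R I M) R M"
proof -
  interpret M: module R M by fact
  interpret I: ideal I R by fact
  show ?thesis unfolding ideal_smult_def
    using I.a_subset by (intro submodule_mod_span assms) auto
qed

lemma ideal_smult_subset:
  assumes "module R M" "ideal I R"
  shows "ideal_smult R I M \<subseteq> carrier M"
  using module.submoduleE(1)[OF assms(1) submodule_ideal_smult[OF assms]] .

text \<open>
  Everything about \<open>IN\<close> and \<open>IN\<^sup>*\<close> below comes from this remark, applied to inclusions, projections,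
  evaluations, automorphisms and their transposes.
\<close>

lemma mod_hom_ideal_smult:
  assumes "module R M" "module R N" "ideal I R" "f \<in> mod_hom R M N" "x \<in> ideal_smult R I M"
  shows "f x \<in> ideal_smult R I N"
proof -
  interpret M: module R M by fact
  interpret I: ideal I R by fact
  have "submodule {x \<in> carrier M. f x \<in> ideal_smult R I N} R M"
    by (rule submodule_vimage[OF assms(1,2,4) submodule_ideal_smult[OF assms(2,3)]])
  then have "ideal_smult R I M \<subseteq> {x \<in> carrier M. f x \<in> ideal_smult R I N}"
    unfolding ideal_smult_def[of R I M]
    by (rule mod_span_minimal)
      (auto simp: mod_homD[OF assms(4)] subsetD[OF I.a_subset] intro!: ideal_smult_smult)
  then show ?thesis using assms(5) by auto
qed

lemma ideal_smult_reg_module: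
  assumes "cring R" "ideal I R"
  shows "ideal_smult R I (reg_module R) \<subseteq> I"
  unfolding ideal_smult_def
  by (rule mod_span_minimal[OF ideal_imp_submodule[OF assms]]) (auto simp: ideal.I_r_closed[OF assms(2)])

lemma ideal_smult_carrier:
  assumes "module R M" "ideal (carrier R) R"
  shows "ideal_smult R (carrier R) M = carrier M"
proof
  interpret module R M by fact
  show "carrier M \<subseteq> ideal_smult R (carrier R) M"
    using ideal_smult_smult[of "\<one>\<^bsub>R\<^esub>" "carrier R" _ M R] by auto
qed (rule ideal_smult_subset[OF assms])

lemma dual_simps [simp]:
  "\<zero>\<^bsub>dual R M\<^esub> = (\<lambda>x\<in>carrier M. \<zero>\<^bsub>R\<^esub>)"
  "f \<oplus>\<^bsub>dual R M\<^esub> g = (\<lambda>x\<in>carrier M. f x \<oplus>\<^bsub>R\<^esub> g x)"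
  "a \<odot>\<^bsub>dual R M\<^esub> f = (\<lambda>x\<in>carrier M. a \<otimes>\<^bsub>R\<^esub> f x)"
  by (simp_all add: dual_def)

lemma dual_iff:
  "f \<in> carrier (dual R M) \<longleftrightarrow> f \<in> extensional (carrier M) \<and>
     (\<forall>x\<in>carrier M. f x \<in> carrier R) \<and>
     (\<forall>x\<in>carrier M. \<forall>y\<in>carrier M. f (x \<oplus>\<^bsub>M\<^esub> y) = f x \<oplus>\<^bsub>R\<^esub> f y) \<and>
     (\<forall>a\<in>carrier R. \<forall>x\<in>carrier M. f (a \<odot>\<^bsub>M\<^esub> x) = a \<otimes>\<^bsub>R\<^esub> f x)"
  by (auto simp: dual_def mod_hom_iff)

lemma dualD:
  assumes "f \<in> carrier (dual R M)" 
  shows "f \<in> mod_hom R M (reg_module R)" "f \<in> extensional (carrier M)"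
    and "x \<in> carrier M \<Longrightarrow> f x \<in> carrier R"
    and "x \<in> carrier M \<Longrightarrow> y \<in> carrier M \<Longrightarrow> f (x \<oplus>\<^bsub>M\<^esub> y) = f x \<oplus>\<^bsub>R\<^esub> f y"
    and "a \<in> carrier R \<Longrightarrow> x \<in> carrier M \<Longrightarrow> f (a \<odot>\<^bsub>M\<^esub> x) = a \<otimes>\<^bsub>R\<^esub> f x"
  using assms by (auto simp: dual_def mod_hom_iff)

lemma module_dual:
  assumes "module R M"
  shows "module R (dual R M)"
proof -
  interpret M: module R M by fact
  show ?thesis
  proof (intro moduleI abelian_groupI)
    fix f assume f: "f \<in> carrier (dual R M)"
    then have "(\<lambda>x\<in>carrier M. \<ominus>\<^bsub>R\<^esub> f x) \<in> carrier (dual R M)"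
      by (auto simp: dual_iff M.R.minus_add M.R.r_minus)
    then show "\<exists>y\<in>carrier (dual R M). y \<oplus>\<^bsub>dual R M\<^esub> f = \<zero>\<^bsub>dual R M\<^esub>"
      using f by (auto intro!: bexI[of _ "\<lambda>x\<in>carrier M. \<ominus>\<^bsub>R\<^esub> f x"] restrict_ext simp: dual_iff M.R.l_neg)
  qed (auto simp: dual_iff M.R.a_ac M.R.m_ac M.R.l_distr M.R.r_distr M.R.is_cring
      extensional_def restrict_def fun_eq_iff)
qed

lemma mod_hom_dual_pullback:
  assumes "module R M" "module R N" "f \<in> mod_hom R M N"
  shows "(\<lambda>g. \<lambda>x\<in>carrier M. g (f x)) \<in> mod_hom R (dual R N) (dual R M)"
proof -
  interpret M: module R M by fact
  show ?thesis
    using assms(3)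
    by (auto simp: mod_hom_iff dual_iff restrict_def fun_eq_iff extensional_def)
qed

lemma mod_hom_eval:
  assumes "module R M" "x \<in> carrier M"
  shows "(\<lambda>f. f x) \<in> mod_hom R (dual R M) (reg_module R)"
  using assms by (auto simp: mod_hom_iff dual_iff)

lemma mod_hom_snd:
  assumes "module R M" "module R N"
  shows "snd \<in> mod_hom R (direct_sum M N) N"
  by (auto simp: mod_hom_iff)

lemma mod_hom_inject_snd:
  assumes "module R M" "module R N"
  shows "(\<lambda>y. (\<zero>\<^bsub>M\<^esub>, y)) \<in> mod_hom R N (direct_sum M N)"
proof -
  interpret M: module R M by fact
  show ?thesis by (auto simp: mod_hom_iff)
qed

section \<open>Dual bases and reflexivity\<close>

lemma (in module) submoduleI_without_inverse:
  assumes "K \<subseteq> carrier M" "\<zero>\<^bsub>M\<^esub> \<in> K"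
    and "\<And>x y. x \<in> K \<Longrightarrow> y \<in> K \<Longrightarrow> x \<oplus>\<^bsub>M\<^esub> y \<in> K"
    and smult: "\<And>a x. a \<in> carrier R \<Longrightarrow> x \<in> K \<Longrightarrow> a \<odot>\<^bsub>M\<^esub> x \<in> K"
  shows "submodule K R M"
proof (rule submoduleI)
  fix x assume x: "x \<in> K"
  then have "\<ominus>\<^bsub>M\<^esub> x = (\<ominus> \<one>) \<odot>\<^bsub>M\<^esub> x" using assms(1) by (auto simp: smult_l_minus)
  then show "\<ominus>\<^bsub>M\<^esub> x \<in> K" using smult x by simp
qed (use assms in auto)

lemma mod_hom_inv_into:
  assumes "module R M" "f \<in> mod_hom R M N" "bij_betw f (carrier M) (carrier N)"
  shows "inv_into (carrier M) f \<in> mod_hom R N M"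
proof -
  interpret M: module R M by fact
  let ?g = "inv_into (carrier M) f"
  have g: "?g y \<in> carrier M" "f (?g y) = y" if "y \<in> carrier N" for y
    using that assms(3) by (auto simp: bij_betw_def inv_into_into f_inv_into_f)
  have eq: "?g y = x" if "x \<in> carrier M" "f x = y" for x y
    using that assms(3) by (auto simp: bij_betw_def)
  show ?thesis
    by (auto simp: mod_hom_iff g mod_homD[OF assms(2)] intro!: eq)
qed

text \<open>
  Embed \<open>M\<close> in a free module by \<open>f\<close> and let \<open>g\<close> be the retraction. The coordinates of \<open>f\<close> and the
  images under \<open>g\<close> of the unit vectors form a dual basis. It may be infinite, but only the
  coordinates that are nonzero at one of finitely many generators matter.
\<close>

lemma dual_basis:
  fixes M :: "('a, 'b, 'm) module_scheme"
  assumes M: "module R M" and fg: "finitely_generated R M" and proj: "projective R M"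
  shows "\<exists>(A :: 'b set) r x. finite A \<and> r \<in> A \<rightarrow> carrier (dual R M) \<and> x \<in> A \<rightarrow> carrier M \<and>
    (\<forall>p\<in>carrier M. (\<Oplus>\<^bsub>M\<^esub>b\<in>A. r b p \<odot>\<^bsub>M\<^esub> x b) = p)"
proof -
  interpret M: module R M by fact
  from proj obtain B :: "'b set" and Q :: "('a, 'b \<Rightarrow> 'a) module" and f where Q: "module R Q"
    and f: "f \<in> mod_hom R (direct_sum M Q) (free_module R B)"
    and bij: "bij_betw f (carrier (direct_sum M Q)) (carrier (free_module R B))"
    unfolding projective_def by blast
  interpret Q: module R Q by fact
  let ?F = "free_module R B"
  have F_simps: "carrier ?F = {c \<in> B \<rightarrow>\<^sub>E carrier R. finite {x \<in> B. c x \<noteq> \<zero>\<^bsub>R\<^esub>}}"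
    "c \<oplus>\<^bsub>?F\<^esub> d = (\<lambda>x\<in>B. c x \<oplus>\<^bsub>R\<^esub> d x)" "a \<odot>\<^bsub>?F\<^esub> c = (\<lambda>x\<in>B. a \<otimes>\<^bsub>R\<^esub> c x)" for a c d
    by (simp_all add: free_module_def)
  define g where "g c = fst (inv_into (carrier (direct_sum M Q)) f c)" for c
  have inv: "inv_into (carrier (direct_sum M Q)) f \<in> mod_hom R ?F (direct_sum M Q)"
    using mod_hom_inv_into[OF module_direct_sum[OF M Q] f bij] .
  have g: "g \<in> mod_hom R ?F M"
    unfolding mod_hom_iff
  proof (intro conjI ballI)
    fix c assume c: "c \<in> carrier ?F"
    obtain m n where mn: "inv_into (carrier (direct_sum M Q)) f c = (m, n)" by fastforce
    have *: "m \<in> carrier M" "n \<in> carrier Q" using mod_homD(1)[OF inv c] mn by auto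
    show "g c \<in> carrier M" using mn * by (simp add: g_def)
    {
      fix a assume "a \<in> carrier R"
      then show "g (a \<odot>\<^bsub>?F\<^esub> c) = a \<odot>\<^bsub>M\<^esub> g c" using mod_homD(3)[OF inv c, of a] mn by (simp add: g_def)
    }
    fix d assume d: "d \<in> carrier ?F"
    obtain m' n' where mn': "inv_into (carrier (direct_sum M Q)) f d = (m', n')" by fastforce
    show "g (c \<oplus>\<^bsub>?F\<^esub> d) = g c \<oplus>\<^bsub>M\<^esub> g d" using mod_homD(2)[OF inv c d] mn mn' by (simp add: g_def)
  qed
  have emb: "f (p, \<zero>\<^bsub>Q\<^esub>) \<in> carrier ?F" "g (f (p, \<zero>\<^bsub>Q\<^esub>)) = p" if "p \<in> carrier M" for p
    using that mod_homD(1)[OF f, of "(p, \<zero>\<^bsub>Q\<^esub>)"] bij by (auto simp: g_def bij_betw_def)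
  define r where "r b = (\<lambda>p\<in>carrier M. f (p, \<zero>\<^bsub>Q\<^esub>) b)" for b
  define d where "d b = (\<lambda>x\<in>B. if x = b then \<one>\<^bsub>R\<^esub> else \<zero>\<^bsub>R\<^esub>)" for b
  have r: "r b \<in> carrier (dual R M)" if b: "b \<in> B" for b
  proof -
    have "f (p \<oplus>\<^bsub>M\<^esub> p', \<zero>\<^bsub>Q\<^esub>) b = f (p, \<zero>\<^bsub>Q\<^esub>) b \<oplus>\<^bsub>R\<^esub> f (p', \<zero>\<^bsub>Q\<^esub>) b"
      if "p \<in> carrier M" "p' \<in> carrier M" for p p'
      using mod_homD(2)[OF f, of "(p, \<zero>\<^bsub>Q\<^esub>)" "(p', \<zero>\<^bsub>Q\<^esub>)"] that b by (simp add: F_simps)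
    moreover have "f (a \<odot>\<^bsub>M\<^esub> p, \<zero>\<^bsub>Q\<^esub>) b = a \<otimes>\<^bsub>R\<^esub> f (p, \<zero>\<^bsub>Q\<^esub>) b"
      if "p \<in> carrier M" "a \<in> carrier R" for p a
      using mod_homD(3)[OF f, of "(p, \<zero>\<^bsub>Q\<^esub>)" a] that b by (simp add: F_simps)
    moreover have "f (p, \<zero>\<^bsub>Q\<^esub>) b \<in> carrier R" if "p \<in> carrier M" for p
      using emb(1)[OF that] b by (auto simp: F_simps)
    ultimately show ?thesis by (auto simp: r_def dual_iff)
  qed
  have d: "d b \<in> carrier ?F" for b
    by (auto simp: d_def F_simps intro: finite_subset[of _ "{b}"])
  \<comment> \<open>by removing one coordinate at a time, no sums in the free module are needed\<close>
  have expand: "g c = (\<Oplus>\<^bsub>M\<^esub>b\<in>A. c b \<odot>\<^bsub>M\<^esub> g (d b))"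
    if "finite A" "A \<subseteq> B" "c \<in> carrier ?F" "\<And>x. x \<in> B - A \<Longrightarrow> c x = \<zero>\<^bsub>R\<^esub>" for A c
    using that
  proof (induction A arbitrary: c rule: finite_induct)
    case empty
    then have "c = \<zero>\<^bsub>R\<^esub> \<odot>\<^bsub>?F\<^esub> c" by (auto simp: F_simps fun_eq_iff PiE_iff extensional_def)
    then show ?case using mod_homD[OF g empty.prems(2)] by (metis M.R.zero_closed M.finsum_empty M.smult_l_null)
  next
    case (insert a A)
    have ca: "c b \<in> carrier R" if "b \<in> B" for b using insert.prems(2) that by (auto simp: F_simps)
    define c' where "c' = (\<lambda>x\<in>B. if x = a then \<zero>\<^bsub>R\<^esub> else c x)"
    have c': "c' \<in> carrier ?F" using insert.prems(2) ca
      by (auto simp: c'_def F_simps intro: finite_subset[of _ "{x \<in> B. c x \<noteq> \<zero>\<^bsub>R\<^esub>}"])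
    have eq: "c = c' \<oplus>\<^bsub>?F\<^esub> (c a \<odot>\<^bsub>?F\<^esub> d a)"
      using insert.prems ca by (auto simp: F_simps c'_def d_def fun_eq_iff PiE_iff extensional_def)
    have "c a \<odot>\<^bsub>?F\<^esub> d a \<in> carrier ?F"
      using insert.prems ca by (auto simp: d_def F_simps intro: finite_subset[of _ "{a}"])
    then have "g c = g c' \<oplus>\<^bsub>M\<^esub> c a \<odot>\<^bsub>M\<^esub> g (d a)"
      using arg_cong[OF eq, of g] mod_homD(2)[OF g c'] mod_homD(3)[OF g d, of "c a"] ca[of a] insert.prems(1) by auto
    also have "g c' = (\<Oplus>\<^bsub>M\<^esub>b\<in>A. c' b \<odot>\<^bsub>M\<^esub> g (d b))"
      using insert.prems by (intro insert.IH c') (auto simp: c'_def)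
    also have "\<dots> = (\<Oplus>\<^bsub>M\<^esub>b\<in>A. c b \<odot>\<^bsub>M\<^esub> g (d b))"
      using insert.hyps insert.prems(1) ca mod_homD(1)[OF g d]
      by (intro M.finsum_cong') (auto simp: c'_def)
    finally show ?case
      using insert.hyps insert.prems(1) ca mod_homD(1)[OF g d]
      by (subst M.finsum_insert) (auto simp: M.a_comm subset_iff)
  qed
  from fg obtain T where T: "finite T" "T \<subseteq> carrier M" "mod_span R M T = carrier M"
    unfolding finitely_generated_def by blast
  define A where "A = (\<Union>p\<in>T. {b \<in> B. f (p, \<zero>\<^bsub>Q\<^esub>) b \<noteq> \<zero>\<^bsub>R\<^esub>})"
  have A: "finite A" "A \<subseteq> B" using T emb(1) by (auto simp: A_def F_simps)
  have "submodule {p \<in> carrier M. \<forall>b\<in>B - A. r b p = \<zero>\<^bsub>R\<^esub>} R M"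
    by (rule M.submoduleI_without_inverse)
      (use mod_hom_zero[OF M module_reg_module[OF M.R.is_cring] dualD(1)[OF r]] dualD[OF r] in auto)
  then have "carrier M \<subseteq> {p \<in> carrier M. \<forall>b\<in>B - A. r b p = \<zero>\<^bsub>R\<^esub>}"
    unfolding T(3)[symmetric] by (rule mod_span_minimal) (use T in \<open>auto simp: A_def r_def\<close>)
  then have "f (p, \<zero>\<^bsub>Q\<^esub>) b = \<zero>\<^bsub>R\<^esub>" if "p \<in> carrier M" "b \<in> B - A" for p b
    using that by (auto simp: r_def)
  then have "(\<Oplus>\<^bsub>M\<^esub>b\<in>A. f (p, \<zero>\<^bsub>Q\<^esub>) b \<odot>\<^bsub>M\<^esub> g (d b)) = p" if "p \<in> carrier M" for p
    using expand[OF A emb(1)[OF that]] emb(2)[OF that] that by simp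
  then have "(\<Oplus>\<^bsub>M\<^esub>b\<in>A. r b p \<odot>\<^bsub>M\<^esub> g (d b)) = p" if "p \<in> carrier M" for p
    using that by (simp add: r_def)
  then show ?thesis using A r mod_homD(1)[OF g d] by (intro exI[of _ A] exI[of _ r] exI[of _ "\<lambda>b. g (d b)"]) auto
qed

text \<open>
  If \<open>r\<close>, \<open>x\<close> is a dual basis of \<open>M\<close>, then \<open>x\<close>, \<open>r\<close> is one of the dual module, so \<open>F\<close> is evaluation at the
  sum of the \<open>F(r\<^sub>b) x\<^sub>b\<close>.
\<close>

lemma dual_reflexive:
  fixes M :: "('a, 'b, 'm) module_scheme"
  assumes M: "module R M" and fg: "finitely_generated R M" and proj: "projective R M"
    and F: "F \<in> carrier (dual R (dual R M))"
  shows "\<exists>p\<in>carrier M. \<forall>f\<in>carrier (dual R M). F f = f p"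
proof -
  interpret M: module R M by (rule M)
  interpret D: module R "dual R M" by (rule module_dual[OF M])
  note reg = module_reg_module[OF M.R.is_cring]
  interpret reg: module R "reg_module R" by (rule reg)
  from dual_basis[OF M fg proj] obtain A r x where A: "finite (A :: 'b set)"
    and r: "r \<in> A \<rightarrow> carrier (dual R M)" and x: "x \<in> A \<rightarrow> carrier M"
    and basis: "\<forall>p\<in>carrier M. (\<Oplus>\<^bsub>M\<^esub>b\<in>A. r b p \<odot>\<^bsub>M\<^esub> x b) = p"
    by (elim exE conjE)
  have x': "x b \<in> carrier M" and r': "r b \<in> carrier (dual R M)" and Fr: "F (r b) \<in> carrier R"
    if "b \<in> A" for b using that x r dualD(3)[OF F] by auto
  let ?p = "\<Oplus>\<^bsub>M\<^esub>b\<in>A. F (r b) \<odot>\<^bsub>M\<^esub> x b"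
  have "F f = f ?p" if f: "f \<in> carrier (dual R M)" for f
  proof -
    have fx: "f (x b) \<in> carrier R" if "b \<in> A" for b using dualD(3)[OF f x'[OF that]] .
    let ?g = "\<Oplus>\<^bsub>dual R M\<^esub>b\<in>A. f (x b) \<odot>\<^bsub>dual R M\<^esub> r b"
    have g_mem: "(\<lambda>b. f (x b) \<odot>\<^bsub>dual R M\<^esub> r b) \<in> A \<rightarrow> carrier (dual R M)"
      using fx r' D.smult_closed by blast
    have "?g = f"
    proof (rule extensionalityI)
      show "?g \<in> extensional (carrier M)" "f \<in> extensional (carrier M)"
        using dualD(2)[OF D.M.finsum_closed[OF g_mem]] dualD(2)[OF f] by auto
    next
      fix p assume p: "p \<in> carrier M"
      have rp: "r b p \<in> carrier R" if "b \<in> A" for b using dualD(3)[OF r'[OF that] p] .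
      have "?g p = (\<Oplus>\<^bsub>reg_module R\<^esub>b\<in>A. (f (x b) \<odot>\<^bsub>dual R M\<^esub> r b) p)"
        using mod_hom_finsum[OF D.module_axioms reg mod_hom_eval[OF M p] A g_mem] .
      also have "\<dots> = (\<Oplus>\<^bsub>reg_module R\<^esub>b\<in>A. f (r b p \<odot>\<^bsub>M\<^esub> x b))"
        using p fx rp x' dualD(5)[OF f] by (intro reg.M.finsum_cong') (auto simp: M.R.m_comm)
      also have "\<dots> = f (\<Oplus>\<^bsub>M\<^esub>b\<in>A. r b p \<odot>\<^bsub>M\<^esub> x b)"
        using rp x' by (intro mod_hom_finsum[OF M reg dualD(1)[OF f] A, symmetric]) auto
      finally show "?g p = f p" using basis p by simp
    qed
    then have "F f = F ?g" by simp
    also have "\<dots> = (\<Oplus>\<^bsub>reg_module R\<^esub>b\<in>A. F (f (x b) \<odot>\<^bsub>dual R M\<^esub> r b))"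
      using mod_hom_finsum[OF D.module_axioms reg dualD(1)[OF F] A g_mem] .
    also have "\<dots> = (\<Oplus>\<^bsub>reg_module R\<^esub>b\<in>A. f (F (r b) \<odot>\<^bsub>M\<^esub> x b))"
      using fx Fr x' r' dualD(5)[OF f] dualD(5)[OF F]
      by (intro reg.M.finsum_cong') (auto simp: M.R.m_comm simp del: dual_simps)
    also have "\<dots> = f ?p"
      using Fr x' by (intro mod_hom_finsum[OF M reg dualD(1)[OF f] A, symmetric]) auto
    finally show ?thesis .
  qed
  moreover have "?p \<in> carrier M" using Fr x' by (intro M.M.finsum_closed) auto
  ultimately show ?thesis by blast
qed

section \<open>Localization at a multiplicative set\<close>

locale localization = module R M for R :: "('a, 'k) ring_scheme" (structure)
    and M :: "('a, 'b, 'm) module_scheme" (structure) +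
  fixes S :: "'a set"
  assumes S_subset: "S \<subseteq> carrier R" and one_S: "\<one>\<^bsub>R\<^esub> \<in> S"
    and mult_S: "\<lbrakk>s \<in> S; t \<in> S\<rbrakk> \<Longrightarrow> s \<otimes>\<^bsub>R\<^esub> t \<in> S"
begin

abbreviation L where "L \<equiv> loc_module R S M"
abbreviation fr where "fr m s \<equiv> fraction R S M (m, s)"

lemma S_carrier [simp]: "s \<in> S \<Longrightarrow> s \<in> carrier R"
  using S_subset by blast

declare one_S [simp] mult_S [simp]

text \<open>
  Scaling of an equation between multiples of \<open>x\<close> and \<open>y\<close>, in the form in which all scalars are collected
  in front, so that commutativity of \<open>R\<close> can be used on them.
\<close>

lemma smult_comb:
  assumes "(a \<otimes>\<^bsub>R\<^esub> b) \<odot>\<^bsub>M\<^esub> x = (c \<otimes>\<^bsub>R\<^esub> d) \<odot>\<^bsub>M\<^esub> y" "{a, b, c, d, k} \<subseteq> carrier R"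
    "x \<in> carrier M" "y \<in> carrier M"
  shows "(k \<otimes>\<^bsub>R\<^esub> (a \<otimes>\<^bsub>R\<^esub> b)) \<odot>\<^bsub>M\<^esub> x = (k \<otimes>\<^bsub>R\<^esub> (c \<otimes>\<^bsub>R\<^esub> d)) \<odot>\<^bsub>M\<^esub> y"
  using assms by (simp add: smult_assoc1)

lemma frac_rel_iff:
  "((m, s), (n, t)) \<in> frac_rel R S M \<longleftrightarrow> m \<in> carrier M \<and> n \<in> carrier M \<and> s \<in> S \<and> t \<in> S \<and>
    (\<exists>u\<in>S. (u \<otimes>\<^bsub>R\<^esub> t) \<odot>\<^bsub>M\<^esub> m = (u \<otimes>\<^bsub>R\<^esub> s) \<odot>\<^bsub>M\<^esub> n)"
  by (auto simp: frac_rel_def smult_assoc1 S_carrier)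

lemma equiv_frac_rel: "equiv (carrier M \<times> S) (frac_rel R S M)"
proof (rule equivI)
  show "frac_rel R S M \<subseteq> (carrier M \<times> S) \<times> (carrier M \<times> S)" by (auto simp: frac_rel_def)
  show "refl_on (carrier M \<times> S) (frac_rel R S M)"
    by (rule refl_onI) (use one_S in \<open>auto simp: frac_rel_iff\<close>)
  show "sym (frac_rel R S M)"
    by (rule symI) (auto simp: frac_rel_def, metis)
  show "trans (frac_rel R S M)"
  proof (rule transI)
    fix p q w assume pq: "(p, q) \<in> frac_rel R S M" and qw: "(q, w) \<in> frac_rel R S M"
    obtain m s n t k r where p: "p = (m, s)" "q = (n, t)" "w = (k, r)" by (metis surj_pair)
    from pq obtain u where u: "u \<in> S" "(u \<otimes>\<^bsub>R\<^esub> t) \<odot>\<^bsub>M\<^esub> m = (u \<otimes>\<^bsub>R\<^esub> s) \<odot>\<^bsub>M\<^esub> n"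
      and c1: "m \<in> carrier M" "n \<in> carrier M" "s \<in> S" "t \<in> S"
      by (auto simp: p frac_rel_iff)
    from qw obtain v where v: "v \<in> S" "(v \<otimes>\<^bsub>R\<^esub> r) \<odot>\<^bsub>M\<^esub> n = (v \<otimes>\<^bsub>R\<^esub> t) \<odot>\<^bsub>M\<^esub> k"
      and c2: "k \<in> carrier M" "r \<in> S"
      by (auto simp: p frac_rel_iff)
    have "((v \<otimes>\<^bsub>R\<^esub> r) \<otimes>\<^bsub>R\<^esub> (u \<otimes>\<^bsub>R\<^esub> t)) \<odot>\<^bsub>M\<^esub> m = ((v \<otimes>\<^bsub>R\<^esub> r) \<otimes>\<^bsub>R\<^esub> (u \<otimes>\<^bsub>R\<^esub> s)) \<odot>\<^bsub>M\<^esub> n"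
      using smult_comb[OF u(2), of "v \<otimes>\<^bsub>R\<^esub> r"] c1 c2 u v by simp
    also have "\<dots> = ((u \<otimes>\<^bsub>R\<^esub> s) \<otimes>\<^bsub>R\<^esub> (v \<otimes>\<^bsub>R\<^esub> r)) \<odot>\<^bsub>M\<^esub> n"
      using c1 c2 u v by (simp add: R.m_comm)
    also have "\<dots> = ((u \<otimes>\<^bsub>R\<^esub> s) \<otimes>\<^bsub>R\<^esub> (v \<otimes>\<^bsub>R\<^esub> t)) \<odot>\<^bsub>M\<^esub> k"
      using smult_comb[OF v(2), of "u \<otimes>\<^bsub>R\<^esub> s"] c1 c2 u v by simp
    finally have "(((u \<otimes>\<^bsub>R\<^esub> v) \<otimes>\<^bsub>R\<^esub> t) \<otimes>\<^bsub>R\<^esub> r) \<odot>\<^bsub>M\<^esub> m = (((u \<otimes>\<^bsub>R\<^esub> v) \<otimes>\<^bsub>R\<^esub> t) \<otimes>\<^bsub>R\<^esub> s) \<odot>\<^bsub>M\<^esub> k"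
      using c1 c2 u v by (simp add: R.m_ac)
    then show "(p, w) \<in> frac_rel R S M"
      using c1 c2 u(1) v(1) unfolding p frac_rel_iff by (auto intro!: bexI[of _ "(u \<otimes>\<^bsub>R\<^esub> v) \<otimes>\<^bsub>R\<^esub> t"])
  qed
qed

lemma fraction_eq_iff:
  assumes "m \<in> carrier M" "n \<in> carrier M" "s \<in> S" "t \<in> S"
  shows "fr m s = fr n t \<longleftrightarrow> (\<exists>u\<in>S. (u \<otimes>\<^bsub>R\<^esub> t) \<odot>\<^bsub>M\<^esub> m = (u \<otimes>\<^bsub>R\<^esub> s) \<odot>\<^bsub>M\<^esub> n)"
  using eq_equiv_class_iff[OF equiv_frac_rel, of "(m, s)" "(n, t)"] assms
  by (simp add: fraction_def frac_rel_iff)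

lemma carrier_L: "carrier L = {fr m s | m s. m \<in> carrier M \<and> s \<in> S}"
  by (auto simp: loc_module_def quotient_def fraction_def)

lemma fr_closed [simp]: "m \<in> carrier M \<Longrightarrow> s \<in> S \<Longrightarrow> fr m s \<in> carrier L"
  by (auto simp: carrier_L)

lemma fr_self:
  assumes "m \<in> carrier M" "s \<in> S" shows "(m, s) \<in> fr m s"
  using equiv_class_self[OF equiv_frac_rel, of "(m, s)"] assms by (simp add: fraction_def)

lemma fr_mem:
  assumes "(n, t) \<in> fr m s" shows "n \<in> carrier M" "t \<in> S" "m \<in> carrier M" "s \<in> S"
    and "\<exists>u\<in>S. (u \<otimes>\<^bsub>R\<^esub> t) \<odot>\<^bsub>M\<^esub> m = (u \<otimes>\<^bsub>R\<^esub> s) \<odot>\<^bsub>M\<^esub> n"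
  using assms by (auto simp: fraction_def frac_rel_iff)

lemma fr_cancel:
  assumes "m \<in> carrier M" "s \<in> S" "t \<in> S"
  shows "fr (t \<odot>\<^bsub>M\<^esub> m) (t \<otimes>\<^bsub>R\<^esub> s) = fr m s"
  using assms by (subst fraction_eq_iff) (auto intro!: bexI[of _ "\<one>\<^bsub>R\<^esub>"] simp: R.m_ac simp flip: smult_assoc1)

lemma fr_add:
  assumes "m \<in> carrier M" "n \<in> carrier M" "s \<in> S" "t \<in> S"
  shows "fr m s \<oplus>\<^bsub>L\<^esub> fr n t = fr (t \<odot>\<^bsub>M\<^esub> m \<oplus>\<^bsub>M\<^esub> s \<odot>\<^bsub>M\<^esub> n) (s \<otimes>\<^bsub>R\<^esub> t)"
proof -
  let ?v = "fr (t \<odot>\<^bsub>M\<^esub> m \<oplus>\<^bsub>M\<^esub> s \<odot>\<^bsub>M\<^esub> n) (s \<otimes>\<^bsub>R\<^esub> t)"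
  have *: "fr (t' \<odot>\<^bsub>M\<^esub> m' \<oplus>\<^bsub>M\<^esub> s' \<odot>\<^bsub>M\<^esub> n') (s' \<otimes>\<^bsub>R\<^esub> t') = ?v"
    if mem: "(m', s') \<in> fr m s" "(n', t') \<in> fr n t" for m' s' n' t'
  proof -
    note c = fr_mem(1-4)[OF mem(1)] fr_mem(1-4)[OF mem(2)]
    obtain u where u: "u \<in> S" "(u \<otimes>\<^bsub>R\<^esub> s') \<odot>\<^bsub>M\<^esub> m = (u \<otimes>\<^bsub>R\<^esub> s) \<odot>\<^bsub>M\<^esub> m'"
      using fr_mem(5)[OF mem(1)] by blast
    obtain v where v: "v \<in> S" "(v \<otimes>\<^bsub>R\<^esub> t') \<odot>\<^bsub>M\<^esub> n = (v \<otimes>\<^bsub>R\<^esub> t) \<odot>\<^bsub>M\<^esub> n'"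
      using fr_mem(5)[OF mem(2)] by blast
    have "((v \<otimes>\<^bsub>R\<^esub> (t' \<otimes>\<^bsub>R\<^esub> t)) \<otimes>\<^bsub>R\<^esub> (u \<otimes>\<^bsub>R\<^esub> s')) \<odot>\<^bsub>M\<^esub> m = ((v \<otimes>\<^bsub>R\<^esub> (t' \<otimes>\<^bsub>R\<^esub> t)) \<otimes>\<^bsub>R\<^esub> (u \<otimes>\<^bsub>R\<^esub> s)) \<odot>\<^bsub>M\<^esub> m'"
      using c u v by (intro smult_comb) auto
    moreover have "((u \<otimes>\<^bsub>R\<^esub> (s' \<otimes>\<^bsub>R\<^esub> s)) \<otimes>\<^bsub>R\<^esub> (v \<otimes>\<^bsub>R\<^esub> t')) \<odot>\<^bsub>M\<^esub> n = ((u \<otimes>\<^bsub>R\<^esub> (s' \<otimes>\<^bsub>R\<^esub> s)) \<otimes>\<^bsub>R\<^esub> (v \<otimes>\<^bsub>R\<^esub> t)) \<odot>\<^bsub>M\<^esub> n'"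
      using c u v by (intro smult_comb) auto
    ultimately have "((u \<otimes>\<^bsub>R\<^esub> v) \<otimes>\<^bsub>R\<^esub> (s \<otimes>\<^bsub>R\<^esub> t)) \<odot>\<^bsub>M\<^esub> (t' \<odot>\<^bsub>M\<^esub> m' \<oplus>\<^bsub>M\<^esub> s' \<odot>\<^bsub>M\<^esub> n')
        = ((u \<otimes>\<^bsub>R\<^esub> v) \<otimes>\<^bsub>R\<^esub> (s' \<otimes>\<^bsub>R\<^esub> t')) \<odot>\<^bsub>M\<^esub> (t \<odot>\<^bsub>M\<^esub> m \<oplus>\<^bsub>M\<^esub> s \<odot>\<^bsub>M\<^esub> n)"
      using c u(1) v(1) by (simp add: smult_r_distr R.m_ac flip: smult_assoc1)
    then show ?thesis
      using c u(1) v(1) by (subst fraction_eq_iff) (auto intro!: bexI[of _ "u \<otimes>\<^bsub>R\<^esub> v"])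
  qed
  have "fr m s \<oplus>\<^bsub>L\<^esub> fr n t
      = (\<Union>(m', s')\<in>fr m s. \<Union>(n', t')\<in>fr n t. fr (t' \<odot>\<^bsub>M\<^esub> m' \<oplus>\<^bsub>M\<^esub> s' \<odot>\<^bsub>M\<^esub> n') (s' \<otimes>\<^bsub>R\<^esub> t'))"
    by (simp add: loc_module_def)
  also have "\<dots> = (\<Union>p\<in>fr m s. \<Union>q\<in>fr n t. ?v)"
    by (intro SUP_cong refl) (auto simp: * split: prod.splits)
  also have "\<dots> = ?v" using fr_self[OF assms(1,3)] fr_self[OF assms(2,4)] by blast
  finally show ?thesis .
qed

lemma fr_smult:
  assumes "a \<in> carrier R" "m \<in> carrier M" "s \<in> S" "t \<in> S"
  shows "fraction R S (reg_module R) (a, s) \<odot>\<^bsub>L\<^esub> fr m t = fr (a \<odot>\<^bsub>M\<^esub> m) (s \<otimes>\<^bsub>R\<^esub> t)"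
proof -
  interpret reg: localization R "reg_module R" S
    by (intro localization.intro localization_axioms.intro module_reg_module R.is_cring S_subset one_S mult_S)
  let ?v = "fr (a \<odot>\<^bsub>M\<^esub> m) (s \<otimes>\<^bsub>R\<^esub> t)"
  have *: "fr (a' \<odot>\<^bsub>M\<^esub> m') (s' \<otimes>\<^bsub>R\<^esub> t') = ?v"
    if mem: "(a', s') \<in> reg.fr a s" "(m', t') \<in> fr m t" for a' s' m' t'
  proof -
    note c = reg.fr_mem(1-4)[OF mem(1)] fr_mem(1-4)[OF mem(2)]
    obtain u where u: "u \<in> S" "(u \<otimes>\<^bsub>R\<^esub> s') \<otimes>\<^bsub>R\<^esub> a = (u \<otimes>\<^bsub>R\<^esub> s) \<otimes>\<^bsub>R\<^esub> a'"
      using reg.fr_mem(5)[OF mem(1)] by auto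
    obtain v where v: "v \<in> S" "(v \<otimes>\<^bsub>R\<^esub> t') \<odot>\<^bsub>M\<^esub> m = (v \<otimes>\<^bsub>R\<^esub> t) \<odot>\<^bsub>M\<^esub> m'"
      using fr_mem(5)[OF mem(2)] by blast
    have "((u \<otimes>\<^bsub>R\<^esub> v) \<otimes>\<^bsub>R\<^esub> (s' \<otimes>\<^bsub>R\<^esub> t')) \<odot>\<^bsub>M\<^esub> (a \<odot>\<^bsub>M\<^esub> m)
        = ((u \<otimes>\<^bsub>R\<^esub> s') \<otimes>\<^bsub>R\<^esub> a) \<odot>\<^bsub>M\<^esub> ((v \<otimes>\<^bsub>R\<^esub> t') \<odot>\<^bsub>M\<^esub> m)"
      using c u(1) v(1) by (simp add: R.m_ac flip: smult_assoc1)
    also have "\<dots> = ((u \<otimes>\<^bsub>R\<^esub> v) \<otimes>\<^bsub>R\<^esub> (s \<otimes>\<^bsub>R\<^esub> t)) \<odot>\<^bsub>M\<^esub> (a' \<odot>\<^bsub>M\<^esub> m')"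
      unfolding u v using c u(1) v(1) by (simp add: R.m_ac flip: smult_assoc1)
    finally show ?thesis
      using c u(1) v(1) by (subst fraction_eq_iff) (auto intro!: bexI[of _ "u \<otimes>\<^bsub>R\<^esub> v"])
  qed
  have "reg.fr a s \<odot>\<^bsub>L\<^esub> fr m t
      = (\<Union>(a', s')\<in>reg.fr a s. \<Union>(m', t')\<in>fr m t. fr (a' \<odot>\<^bsub>M\<^esub> m') (s' \<otimes>\<^bsub>R\<^esub> t'))"
    by (simp add: loc_module_def)
  also have "\<dots> = (\<Union>p\<in>reg.fr a s. \<Union>q\<in>fr m t. ?v)"
    by (intro SUP_cong refl) (auto simp: * split: prod.splits)
  also have "\<dots> = ?v" using reg.fr_self[of a s] fr_self[of m t] assms by auto
  finally show ?thesis .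
qed

lemma fr_add_same:
  assumes "m \<in> carrier M" "n \<in> carrier M" "s \<in> S"
  shows "fr m s \<oplus>\<^bsub>L\<^esub> fr n s = fr (m \<oplus>\<^bsub>M\<^esub> n) s"
  using fr_cancel[of "m \<oplus>\<^bsub>M\<^esub> n" s s] assms by (simp add: fr_add smult_r_distr)

lemma zero_L: "s \<in> S \<Longrightarrow> \<zero>\<^bsub>L\<^esub> = fr \<zero>\<^bsub>M\<^esub> s"
  using fr_cancel[of "\<zero>\<^bsub>M\<^esub>" "\<one>\<^bsub>R\<^esub>" s] by (simp add: loc_module_def)

lemma abelian_monoid_L: "abelian_monoid L"
proof (rule abelian_monoidI)
  fix x y z assume "x \<in> carrier L" "y \<in> carrier L" "z \<in> carrier L"
  then obtain m s n t k r where *: "x = fr m s" "y = fr n t" "z = fr k r" "m \<in> carrier M" "n \<in> carrier M"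
    "k \<in> carrier M" "s \<in> S" "t \<in> S" "r \<in> S" by (auto simp: carrier_L)
  then show "x \<oplus>\<^bsub>L\<^esub> y \<oplus>\<^bsub>L\<^esub> z = x \<oplus>\<^bsub>L\<^esub> (y \<oplus>\<^bsub>L\<^esub> z)"
    by (simp add: fr_add smult_r_distr M.a_ac R.m_ac flip: smult_assoc1)
next
  show "\<zero>\<^bsub>L\<^esub> \<in> carrier L" by (simp add: zero_L[OF one_S])
next
  fix x assume "x \<in> carrier L"
  then show "\<zero>\<^bsub>L\<^esub> \<oplus>\<^bsub>L\<^esub> x = x" by (auto simp: carrier_L fr_add zero_L[OF one_S])
next
  fix x y assume "x \<in> carrier L" "y \<in> carrier L"
  then show "x \<oplus>\<^bsub>L\<^esub> y = y \<oplus>\<^bsub>L\<^esub> x" by (auto simp: carrier_L fr_add M.a_comm R.m_comm)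
next
  fix x y assume "x \<in> carrier L" "y \<in> carrier L"
  then obtain m s n t where "x = fr m s" "y = fr n t" "m \<in> carrier M" "n \<in> carrier M" "s \<in> S" "t \<in> S"
    by (auto simp: carrier_L)
  then show "x \<oplus>\<^bsub>L\<^esub> y \<in> carrier L" by (simp add: fr_add)
qed

lemma finsum_L:
  assumes "finite A" "f \<in> A \<rightarrow> carrier M" "s \<in> S"
  shows "(\<Oplus>\<^bsub>L\<^esub>i\<in>A. fr (f i) s) = fr (\<Oplus>\<^bsub>M\<^esub>i\<in>A. f i) s"
proof -
  interpret L: abelian_monoid L by (rule abelian_monoid_L)
  show ?thesis
    using assms(1,2)
    by (induction A rule: finite_induct) (use assms(3) in \<open>auto simp: zero_L[OF assms(3)] fr_add_same Pi_iff\<close>)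
qed

lemma common_denominator:
  assumes "finite A" "e \<in> A \<rightarrow> carrier L"
  shows "\<exists>s\<in>S. \<exists>m\<in>A \<rightarrow> carrier M. \<forall>i\<in>A. e i = fr (m i) s"
  using assms
proof (induction A rule: finite_induct)
  case empty then show ?case by (intro bexI[OF _ one_S]) auto
next
  case (insert a A)
  then obtain s m where s: "s \<in> S" "m \<in> A \<rightarrow> carrier M" "\<forall>i\<in>A. e i = fr (m i) s" by auto
  from insert.prems obtain k t where k: "e a = fr k t" "k \<in> carrier M" "t \<in> S"
    by (auto simp: carrier_L)
  show ?case
  proof (intro bexI ballI)
    fix i assume "i \<in> insert a A"
    then show "e i = fr (if i = a then s \<odot>\<^bsub>M\<^esub> k else t \<odot>\<^bsub>M\<^esub> m i) (t \<otimes>\<^bsub>R\<^esub> s)"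
      using k s fr_cancel[of k t s] fr_cancel[of "m i" s t] by (auto simp: R.m_comm Pi_iff)
  qed (use k s in \<open>auto simp: Pi_iff\<close>)
qed

text \<open>
  Clearing denominators turns a basis of the localized module into elements of \<open>M\<close> that span and are
  independent up to factors in \<open>S\<close>, so that the localization can be forgotten afterwards.
\<close>

lemma free_imp_basis_up_to_denominators:
  assumes "free_of_rank (loc_ring R S) L n"
  obtains m where "m \<in> {..<n} \<rightarrow> carrier M"
    "\<And>x. x \<in> carrier M \<Longrightarrow> \<exists>v\<in>S. \<exists>a\<in>{..<n} \<rightarrow> carrier R. v \<odot>\<^bsub>M\<^esub> x = (\<Oplus>\<^bsub>M\<^esub>i\<in>{..<n}. a i \<odot>\<^bsub>M\<^esub> m i)"
    "\<And>a i. a \<in> {..<n} \<rightarrow> carrier R \<Longrightarrow> (\<Oplus>\<^bsub>M\<^esub>i\<in>{..<n}. a i \<odot>\<^bsub>M\<^esub> m i) = \<zero>\<^bsub>M\<^esub> \<Longrightarrow> i < n \<Longrightarrow> \<exists>u\<in>S. u \<otimes>\<^bsub>R\<^esub> a i = \<zero>\<^bsub>R\<^esub>"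
proof -
  interpret reg: localization R "reg_module R" S
    by (intro localization.intro localization_axioms.intro module_reg_module R.is_cring S_subset one_S mult_S)
  interpret L: abelian_monoid L by (rule abelian_monoid_L)
  have K: "carrier (loc_ring R S) = carrier reg.L" by (simp add: loc_ring_def)
  from assms[unfolded free_of_rank_def K] obtain e where e: "e \<in> {..<n} \<rightarrow> carrier L"
    and uniq: "\<forall>x\<in>carrier L. \<exists>!c. c \<in> {..<n} \<rightarrow>\<^sub>E carrier reg.L \<and> x = (\<Oplus>\<^bsub>L\<^esub>i\<in>{..<n}. c i \<odot>\<^bsub>L\<^esub> e i)"
    by (elim bexE)
  obtain s m where s: "s \<in> S" and m: "m \<in> {..<n} \<rightarrow> carrier M" and em: "\<And>i. i < n \<Longrightarrow> e i = fr (m i) s"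
    using common_denominator[OF finite_lessThan e] by auto
  have comb: "(\<Oplus>\<^bsub>L\<^esub>i\<in>{..<n}. c i \<odot>\<^bsub>L\<^esub> e i) = fr (\<Oplus>\<^bsub>M\<^esub>i\<in>{..<n}. a i \<odot>\<^bsub>M\<^esub> m i) (d \<otimes>\<^bsub>R\<^esub> s)"
    if a: "a \<in> {..<n} \<rightarrow> carrier R" and d: "d \<in> S" and c: "\<And>i. i < n \<Longrightarrow> c i = reg.fr (a i) d" for a c d
  proof -
    have "(\<Oplus>\<^bsub>L\<^esub>i\<in>{..<n}. c i \<odot>\<^bsub>L\<^esub> e i) = (\<Oplus>\<^bsub>L\<^esub>i\<in>{..<n}. fr (a i \<odot>\<^bsub>M\<^esub> m i) (d \<otimes>\<^bsub>R\<^esub> s))"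
      using a d s m by (intro L.finsum_cong') (auto simp: c em fr_smult Pi_iff)
    then show ?thesis using a d s m by (subst (asm) finsum_L) auto
  qed
  show ?thesis
  proof (rule that[OF m])
    fix x assume x: "x \<in> carrier M"
    then obtain c where c: "c \<in> {..<n} \<rightarrow>\<^sub>E carrier reg.L" "fr x \<one>\<^bsub>R\<^esub> = (\<Oplus>\<^bsub>L\<^esub>i\<in>{..<n}. c i \<odot>\<^bsub>L\<^esub> e i)"
      using bspec[OF uniq, of "fr x \<one>\<^bsub>R\<^esub>"] by auto
    have "c \<in> {..<n} \<rightarrow> carrier reg.L" using c(1) by auto
    then obtain d a where d: "d \<in> S" "a \<in> {..<n} \<rightarrow> carrier R" "\<And>i. i < n \<Longrightarrow> c i = reg.fr (a i) d"
      using reg.common_denominator[OF finite_lessThan, of c n] by auto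
    let ?y = "\<Oplus>\<^bsub>M\<^esub>i\<in>{..<n}. a i \<odot>\<^bsub>M\<^esub> m i"
    have am: "(\<lambda>i. a i \<odot>\<^bsub>M\<^esub> m i) \<in> {..<n} \<rightarrow> carrier M" using d m by auto
    have y: "?y \<in> carrier M" using am by simp
    have "fr x \<one>\<^bsub>R\<^esub> = fr ?y (d \<otimes>\<^bsub>R\<^esub> s)"
      unfolding c(2) using d by (intro comb) auto
    then obtain u where u: "u \<in> S" "(u \<otimes>\<^bsub>R\<^esub> (d \<otimes>\<^bsub>R\<^esub> s)) \<odot>\<^bsub>M\<^esub> x = (u \<otimes>\<^bsub>R\<^esub> \<one>\<^bsub>R\<^esub>) \<odot>\<^bsub>M\<^esub> ?y"
      using x y d s by (subst (asm) fraction_eq_iff) auto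
    have "u \<odot>\<^bsub>M\<^esub> ?y = (\<Oplus>\<^bsub>M\<^esub>i\<in>{..<n}. u \<odot>\<^bsub>M\<^esub> (a i \<odot>\<^bsub>M\<^esub> m i))"
      using u(1) am by (intro finsum_smult_ldistr) auto
    also have "\<dots> = (\<Oplus>\<^bsub>M\<^esub>i\<in>{..<n}. (u \<otimes>\<^bsub>R\<^esub> a i) \<odot>\<^bsub>M\<^esub> m i)"
      using u(1) d m by (intro M.finsum_cong') (auto simp: smult_assoc1 Pi_iff)
    finally show "\<exists>v\<in>S. \<exists>a\<in>{..<n} \<rightarrow> carrier R. v \<odot>\<^bsub>M\<^esub> x = (\<Oplus>\<^bsub>M\<^esub>i\<in>{..<n}. a i \<odot>\<^bsub>M\<^esub> m i)"
      using u d s by (intro bexI[of _ "u \<otimes>\<^bsub>R\<^esub> (d \<otimes>\<^bsub>R\<^esub> s)"] bexI[of _ "\<lambda>i. u \<otimes>\<^bsub>R\<^esub> a i"]) auto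
  next
    fix a i assume a: "a \<in> {..<n} \<rightarrow> carrier R" and z: "(\<Oplus>\<^bsub>M\<^esub>i\<in>{..<n}. a i \<odot>\<^bsub>M\<^esub> m i) = \<zero>\<^bsub>M\<^esub>" and i: "i < n"
    define c where "c = (\<lambda>i\<in>{..<n}. reg.fr (a i) \<one>\<^bsub>R\<^esub>)"
    \<comment> \<open>the family \<open>c\<close> and the zero family represent the same element, hence agree\<close>
    define c0 where "c0 = (\<lambda>i\<in>{..<n}. reg.fr \<zero>\<^bsub>R\<^esub> \<one>\<^bsub>R\<^esub>)"
    have c: "\<zero>\<^bsub>L\<^esub> = (\<Oplus>\<^bsub>L\<^esub>i\<in>{..<n}. c i \<odot>\<^bsub>L\<^esub> e i)"
      using comb[of a "\<one>\<^bsub>R\<^esub>" c] a s by (simp add: c_def z zero_L[OF s])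
    have "(\<Oplus>\<^bsub>M\<^esub>i\<in>{..<n}. \<zero>\<^bsub>R\<^esub> \<odot>\<^bsub>M\<^esub> m i) = \<zero>\<^bsub>M\<^esub>"
      using m by (intro M.add.finprod_one_eqI) (auto simp: Pi_iff)
    then have c0: "\<zero>\<^bsub>L\<^esub> = (\<Oplus>\<^bsub>L\<^esub>i\<in>{..<n}. c0 i \<odot>\<^bsub>L\<^esub> e i)"
      using comb[of "\<lambda>_. \<zero>\<^bsub>R\<^esub>" "\<one>\<^bsub>R\<^esub>" c0] s by (simp add: c0_def zero_L[OF s])
    have c_mem: "c \<in> {..<n} \<rightarrow>\<^sub>E carrier reg.L" "c0 \<in> {..<n} \<rightarrow>\<^sub>E carrier reg.L"
      using a by (auto simp: c_def c0_def intro!: reg.fr_closed)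
    have ex1D: "a = b" if "\<exists>!c. Q c" "Q a" "Q b" for Q and a b :: "nat \<Rightarrow> ('a \<times> 'a) set"
      using that by blast
    have "c = c0"
      by (rule ex1D[OF bspec[OF uniq L.zero_closed]]) (intro conjI, fact+)+
    then have "reg.fr (a i) \<one>\<^bsub>R\<^esub> = reg.fr \<zero>\<^bsub>R\<^esub> \<one>\<^bsub>R\<^esub>" using i by (auto simp: c_def c0_def dest: fun_cong[of _ _ i])
    then show "\<exists>u\<in>S. u \<otimes>\<^bsub>R\<^esub> a i = \<zero>\<^bsub>R\<^esub>"
      using a i by (subst (asm) reg.fraction_eq_iff) auto
  qed
qed

end

section \<open>Rank and two-by-two minors\<close>

text \<open>
  Let \<open>m\<^sub>0\<close>, \<open>m\<^sub>1\<close> be two members of a basis up to denominators at \<open>P\<close>, and let \<open>PM\<close> be the elements of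
  \<open>M\<close> whose coordinates lie in \<open>P\<close> up to denominators. By the dual basis, an element on which all
  functionals take values in \<open>P\<close> lies in \<open>PM\<close>. As \<open>m\<^sub>0\<close> does not, some \<open>f\<close> has \<open>f(m\<^sub>0)\<close> outside \<open>P\<close>. Then
  \<open>f(m\<^sub>0) m\<^sub>1 - f(m\<^sub>1) m\<^sub>0\<close> is not in \<open>PM\<close> either, and the value at it of a second functional is a minor.
\<close>

lemma minor_notin_prime:
  fixes R :: "('a, 'k) ring_scheme" and M :: "('a, 'b, 'm) module_scheme"
  assumes M: "module R M" and fg: "finitely_generated R M" and proj: "projective R M"
    and rank: "rank_at_least R M 2" and P: "primeideal P R"
  shows "\<exists>x\<in>carrier M. \<exists>y\<in>carrier M. \<exists>r\<in>carrier (dual R M). \<exists>s\<in>carrier (dual R M).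
    r x \<otimes>\<^bsub>R\<^esub> s y \<ominus>\<^bsub>R\<^esub> r y \<otimes>\<^bsub>R\<^esub> s x \<notin> P"
proof -
  interpret module R M by (rule M)
  interpret P: primeideal P R by (rule P)
  define S where "S = carrier R - P"
  have one: "\<one>\<^bsub>R\<^esub> \<notin> P" using P.I_notcarr P.one_imp_carrier by blast
  interpret localization R M S
    by (intro localization.intro localization_axioms.intro M) (use one P.I_prime in \<open>auto simp: S_def\<close>)
  obtain n where n: "n \<ge> 2" and free: "free_of_rank (loc_ring R S) L n"
    using rank P unfolding rank_at_least_def S_def by blast
  obtain m where m: "m \<in> {..<n} \<rightarrow> carrier M"
    and span: "\<And>x. x \<in> carrier M \<Longrightarrow>
      \<exists>v\<in>S. \<exists>a\<in>{..<n} \<rightarrow> carrier R. v \<odot>\<^bsub>M\<^esub> x = (\<Oplus>\<^bsub>M\<^esub>i\<in>{..<n}. a i \<odot>\<^bsub>M\<^esub> m i)"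
    and indep: "\<And>a i. a \<in> {..<n} \<rightarrow> carrier R \<Longrightarrow> (\<Oplus>\<^bsub>M\<^esub>i\<in>{..<n}. a i \<odot>\<^bsub>M\<^esub> m i) = \<zero>\<^bsub>M\<^esub> \<Longrightarrow>
      i < n \<Longrightarrow> \<exists>u\<in>S. u \<otimes>\<^bsub>R\<^esub> a i = \<zero>\<^bsub>R\<^esub>"
    using free_imp_basis_up_to_denominators[OF free] by blast
  have P_add: "a \<oplus>\<^bsub>R\<^esub> b \<in> P" if "a \<in> P" "b \<in> P" for a b
    using additive_subgroup.a_closed[OF ideal.axioms(1)[OF P.ideal_axioms]] that by blast
  define C where "C a = (\<Oplus>\<^bsub>M\<^esub>i\<in>{..<n}. a i \<odot>\<^bsub>M\<^esub> m i)" for a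
  have mi: "m i \<in> carrier M" if "i < n" for i using m that by auto
  have C_closed: "C a \<in> carrier M" if "a \<in> {..<n} \<rightarrow> carrier R" for a
    unfolding C_def using that m by (intro M.finsum_closed) auto
  have C_add: "C a \<oplus>\<^bsub>M\<^esub> C b = C (\<lambda>i. a i \<oplus>\<^bsub>R\<^esub> b i)"
    if "a \<in> {..<n} \<rightarrow> carrier R" "b \<in> {..<n} \<rightarrow> carrier R" for a b
  proof -
    have "C (\<lambda>i. a i \<oplus>\<^bsub>R\<^esub> b i) = (\<Oplus>\<^bsub>M\<^esub>i\<in>{..<n}. a i \<odot>\<^bsub>M\<^esub> m i \<oplus>\<^bsub>M\<^esub> b i \<odot>\<^bsub>M\<^esub> m i)"
      unfolding C_def using that m by (intro M.finsum_cong') (auto simp: Pi_iff smult_l_distr)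
    then show ?thesis
      unfolding C_def using that m by (subst (asm) M.finsum_addf) auto
  qed
  have C_smult: "k \<odot>\<^bsub>M\<^esub> C a = C (\<lambda>i. k \<otimes>\<^bsub>R\<^esub> a i)" if "a \<in> {..<n} \<rightarrow> carrier R" "k \<in> carrier R" for a k
    unfolding C_def using that m
    by (subst finsum_smult_ldistr) (auto simp: Pi_iff smult_assoc1 intro!: M.finsum_cong')
  have C_unit: "C (\<lambda>i. if i = j then \<one>\<^bsub>R\<^esub> else \<zero>\<^bsub>R\<^esub>) = m j" if "j < n" for j
  proof -
    have "C (\<lambda>i. if i = j then \<one>\<^bsub>R\<^esub> else \<zero>\<^bsub>R\<^esub>) = (\<Oplus>\<^bsub>M\<^esub>i\<in>{..<n}. if j = i then m i else \<zero>\<^bsub>M\<^esub>)"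
      unfolding C_def using m by (intro M.finsum_cong') (auto simp: Pi_iff)
    then show ?thesis using that m by (simp add: M.add.finprod_singleton)
  qed
  define PM where "PM = {y \<in> carrier M. \<exists>v\<in>S. \<exists>a\<in>{..<n} \<rightarrow> P. v \<odot>\<^bsub>M\<^esub> y = C a}"
  have P_sub: "a \<in> {..<n} \<rightarrow> carrier R" if "a \<in> {..<n} \<rightarrow> P" for a using that P.a_subset by auto
  have PM_add: "x \<oplus>\<^bsub>M\<^esub> y \<in> PM" if "x \<in> PM" "y \<in> PM" for x y
  proof -
    from that obtain u a v b where *: "u \<in> S" "v \<in> S" "a \<in> {..<n} \<rightarrow> P" "b \<in> {..<n} \<rightarrow> P"
      "u \<odot>\<^bsub>M\<^esub> x = C a" "v \<odot>\<^bsub>M\<^esub> y = C b" "x \<in> carrier M" "y \<in> carrier M"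
      unfolding PM_def by blast
    have "(u \<otimes>\<^bsub>R\<^esub> v) \<odot>\<^bsub>M\<^esub> (x \<oplus>\<^bsub>M\<^esub> y) = v \<odot>\<^bsub>M\<^esub> (u \<odot>\<^bsub>M\<^esub> x) \<oplus>\<^bsub>M\<^esub> u \<odot>\<^bsub>M\<^esub> (v \<odot>\<^bsub>M\<^esub> y)"
      using *(1,2,7,8) by (simp add: smult_r_distr R.m_comm flip: smult_assoc1)
    also have "\<dots> = C (\<lambda>i. v \<otimes>\<^bsub>R\<^esub> a i \<oplus>\<^bsub>R\<^esub> u \<otimes>\<^bsub>R\<^esub> b i)"
      using *(1-4) P_sub[OF *(3)] P_sub[OF *(4)] by (simp add: *(5,6) C_smult) (subst C_add, auto)
    finally show ?thesis
      using * P.I_l_closed P_add unfolding PM_def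
      by (auto simp: Pi_iff intro!: bexI[of _ "u \<otimes>\<^bsub>R\<^esub> v"] bexI[of _ "\<lambda>i. v \<otimes>\<^bsub>R\<^esub> a i \<oplus>\<^bsub>R\<^esub> u \<otimes>\<^bsub>R\<^esub> b i"])
  qed
  have PM_smult: "p \<odot>\<^bsub>M\<^esub> x \<in> PM" if pP: "p \<in> P" and xM: "x \<in> carrier M" for p x
  proof -
    have p: "p \<in> carrier R" using pP P.a_subset by blast
    obtain v a where va: "v \<in> S" "a \<in> {..<n} \<rightarrow> carrier R" "v \<odot>\<^bsub>M\<^esub> x = C a"
      using span[OF xM] unfolding C_def by blast
    have "v \<odot>\<^bsub>M\<^esub> (p \<odot>\<^bsub>M\<^esub> x) = p \<odot>\<^bsub>M\<^esub> (v \<odot>\<^bsub>M\<^esub> x)"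
      using va(1) p xM by (simp add: R.m_comm flip: smult_assoc1)
    also have "\<dots> = C (\<lambda>i. p \<otimes>\<^bsub>R\<^esub> a i)" using va p by (simp add: C_smult)
    finally show ?thesis
      using va p pP xM P.I_r_closed unfolding PM_def
      by (auto intro!: bexI[of _ v] bexI[of _ "\<lambda>i. p \<otimes>\<^bsub>R\<^esub> a i"])
  qed
  have PM_coeff: "a i \<in> P" if a: "a \<in> {..<n} \<rightarrow> carrier R" and PM: "C a \<in> PM" and i: "i < n" for a i
  proof -
    from PM obtain v b where vb: "v \<in> S" "b \<in> {..<n} \<rightarrow> P" "v \<odot>\<^bsub>M\<^esub> C a = C b" unfolding PM_def by blast
    note b = P_sub[OF vb(2)]
    have "C (\<lambda>i. v \<otimes>\<^bsub>R\<^esub> a i \<oplus>\<^bsub>R\<^esub> (\<ominus>\<^bsub>R\<^esub> \<one>\<^bsub>R\<^esub>) \<otimes>\<^bsub>R\<^esub> b i) = C (\<lambda>i. v \<otimes>\<^bsub>R\<^esub> a i) \<oplus>\<^bsub>M\<^esub> C (\<lambda>i. (\<ominus>\<^bsub>R\<^esub> \<one>\<^bsub>R\<^esub>) \<otimes>\<^bsub>R\<^esub> b i)"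
      using a b vb(1) by (subst C_add) auto
    also have "\<dots> = v \<odot>\<^bsub>M\<^esub> C a \<oplus>\<^bsub>M\<^esub> (\<ominus>\<^bsub>R\<^esub> \<one>\<^bsub>R\<^esub>) \<odot>\<^bsub>M\<^esub> C b"
      using a b vb(1) by (simp add: C_smult)
    also have "\<dots> = \<zero>\<^bsub>M\<^esub>" using C_closed[OF b] by (simp add: vb(3) smult_l_minus M.r_neg)
    finally have "C (\<lambda>i. v \<otimes>\<^bsub>R\<^esub> a i \<oplus>\<^bsub>R\<^esub> (\<ominus>\<^bsub>R\<^esub> \<one>\<^bsub>R\<^esub>) \<otimes>\<^bsub>R\<^esub> b i) = \<zero>\<^bsub>M\<^esub>" .
    moreover have "(\<lambda>i. v \<otimes>\<^bsub>R\<^esub> a i \<oplus>\<^bsub>R\<^esub> (\<ominus>\<^bsub>R\<^esub> \<one>\<^bsub>R\<^esub>) \<otimes>\<^bsub>R\<^esub> b i) \<in> {..<n} \<rightarrow> carrier R"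
      using a b vb(1) by (auto simp: Pi_iff)
    ultimately obtain u where u: "u \<in> S" "u \<otimes>\<^bsub>R\<^esub> (v \<otimes>\<^bsub>R\<^esub> a i \<oplus>\<^bsub>R\<^esub> (\<ominus>\<^bsub>R\<^esub> \<one>\<^bsub>R\<^esub>) \<otimes>\<^bsub>R\<^esub> b i) = \<zero>\<^bsub>R\<^esub>"
      using indep[OF _ _ i] unfolding C_def by blast
    have c: "a i \<in> carrier R" "b i \<in> P" "b i \<in> carrier R" using a b vb(2) i by auto
    have "u \<otimes>\<^bsub>R\<^esub> (v \<otimes>\<^bsub>R\<^esub> a i) \<ominus>\<^bsub>R\<^esub> u \<otimes>\<^bsub>R\<^esub> b i = \<zero>\<^bsub>R\<^esub>"
      using u vb(1) c by (simp add: R.r_distr R.minus_eq R.l_minus R.r_minus)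
    then have "(u \<otimes>\<^bsub>R\<^esub> v) \<otimes>\<^bsub>R\<^esub> a i = u \<otimes>\<^bsub>R\<^esub> b i"
      using u vb(1) c by (simp add: R.r_right_minus_eq R.m_assoc)
    then have "(u \<otimes>\<^bsub>R\<^esub> v) \<otimes>\<^bsub>R\<^esub> a i \<in> P" using P.I_l_closed c u(1) by simp
    moreover have "u \<otimes>\<^bsub>R\<^esub> v \<in> S" using u(1) vb(1) by simp
    ultimately show ?thesis using P.I_prime c(1) unfolding S_def by blast
  qed
  from dual_basis[OF M fg proj] obtain A r x where A: "finite (A :: 'b set)"
    and rx: "r \<in> A \<rightarrow> carrier (dual R M)" "x \<in> A \<rightarrow> carrier M"
    and "\<forall>p\<in>carrier M. (\<Oplus>\<^bsub>M\<^esub>b\<in>A. r b p \<odot>\<^bsub>M\<^esub> x b) = p"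
    by (elim exE conjE)
  then have basis: "(\<Oplus>\<^bsub>M\<^esub>b\<in>A. r b p \<odot>\<^bsub>M\<^esub> x b) = p" if "p \<in> carrier M" for p
    using that by simp
  have r: "r b \<in> carrier (dual R M)" and x: "x b \<in> carrier M" if "b \<in> A" for b
    using rx that by auto
  have detect: "\<exists>f\<in>carrier (dual R M). f y \<notin> P" if y: "y \<in> carrier M" "y \<notin> PM" for y
  proof (rule ccontr)
    assume "\<not> ?thesis"
    then have rP: "r b y \<in> P" if "b \<in> A" for b using r that by blast
    have sum: "(\<Oplus>\<^bsub>M\<^esub>b\<in>B. r b y \<odot>\<^bsub>M\<^esub> x b) \<in> PM" if "B \<subseteq> A" for B
      using finite_subset[OF that A] that
    proof (induction B rule: finite_induct)
      case empty
      show ?case using PM_smult[of "\<zero>\<^bsub>R\<^esub>" "\<zero>\<^bsub>M\<^esub>"] by simp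
    next
      case (insert b B)
      then have "(\<lambda>b. r b y \<odot>\<^bsub>M\<^esub> x b) \<in> B \<rightarrow> carrier M" "r b y \<odot>\<^bsub>M\<^esub> x b \<in> carrier M"
        using dualD(3)[OF r y(1)] x by auto
      then show ?case using insert PM_add PM_smult[OF rP x] by simp
    qed
    show False using sum[OF subset_refl] basis[OF y(1)] y(2) by simp
  qed
  have lt: "0 < n" "1 < n" using n by auto
  have ne: "(1::nat) \<noteq> 0" by simp
  let ?d = "\<lambda>j i. if i = j then \<one>\<^bsub>R\<^esub> else \<zero>\<^bsub>R\<^esub>"
  have "m 0 \<notin> PM" using PM_coeff[of "?d 0" 0] C_unit lt(1) one by auto
  then obtain f where f: "f \<in> carrier (dual R M)" "f (m 0) \<notin> P" using detect mi lt by blast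
  have fc: "f (m 0) \<in> carrier R" "f (m 1) \<in> carrier R" using dualD(3)[OF f(1)] mi lt by auto
  define y where "y = f (m 0) \<odot>\<^bsub>M\<^esub> m 1 \<oplus>\<^bsub>M\<^esub> (\<ominus>\<^bsub>R\<^esub> f (m 1)) \<odot>\<^bsub>M\<^esub> m 0"
  have y: "y \<in> carrier M" using fc mi lt by (simp add: y_def)
  have d: "?d j \<in> {..<n} \<rightarrow> carrier R" for j by simp
  have kd: "(\<lambda>i. k \<otimes>\<^bsub>R\<^esub> ?d j i) \<in> {..<n} \<rightarrow> carrier R" if "k \<in> carrier R" for k and j :: nat
    using that by simp
  have "y = f (m 0) \<odot>\<^bsub>M\<^esub> C (?d 1) \<oplus>\<^bsub>M\<^esub> (\<ominus>\<^bsub>R\<^esub> f (m 1)) \<odot>\<^bsub>M\<^esub> C (?d 0)"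
    by (simp only: y_def C_unit[OF lt(1)] C_unit[OF lt(2)])
  also have "\<dots> = C (\<lambda>i. f (m 0) \<otimes>\<^bsub>R\<^esub> ?d 1 i) \<oplus>\<^bsub>M\<^esub> C (\<lambda>i. (\<ominus>\<^bsub>R\<^esub> f (m 1)) \<otimes>\<^bsub>R\<^esub> ?d 0 i)"
    by (simp only: C_smult[OF d fc(1)] C_smult[OF d R.a_inv_closed[OF fc(2)]])
  also have "\<dots> = C (\<lambda>i. f (m 0) \<otimes>\<^bsub>R\<^esub> ?d 1 i \<oplus>\<^bsub>R\<^esub> (\<ominus>\<^bsub>R\<^esub> f (m 1)) \<otimes>\<^bsub>R\<^esub> ?d 0 i)"
    by (rule C_add[OF kd[OF fc(1)] kd[OF R.a_inv_closed[OF fc(2)]]])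
  finally have "y = C (\<lambda>i. f (m 0) \<otimes>\<^bsub>R\<^esub> ?d 1 i \<oplus>\<^bsub>R\<^esub> (\<ominus>\<^bsub>R\<^esub> f (m 1)) \<otimes>\<^bsub>R\<^esub> ?d 0 i)" .
  then have "y \<notin> PM"
    using PM_coeff[of "\<lambda>i. f (m 0) \<otimes>\<^bsub>R\<^esub> ?d 1 i \<oplus>\<^bsub>R\<^esub> (\<ominus>\<^bsub>R\<^esub> f (m 1)) \<otimes>\<^bsub>R\<^esub> ?d 0 i" 1] fc f(2) lt(2)
    by auto
  then obtain s where s: "s \<in> carrier (dual R M)" "s y \<notin> P" using detect y by blast
  have "s y = f (m 0) \<otimes>\<^bsub>R\<^esub> s (m 1) \<ominus>\<^bsub>R\<^esub> f (m 1) \<otimes>\<^bsub>R\<^esub> s (m 0)"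
    using fc mi lt dualD(3)[OF s(1)] by (simp add: y_def dualD(4,5)[OF s(1)] R.minus_eq R.l_minus)
  then show ?thesis using s f mi lt by metis
qed

section \<open>Transvections as automorphisms\<close>

lemma carrier_Aut_mod: "carrier (Aut_mod R N) = mod_hom R N N \<inter> Bij (carrier N)"
  by (simp add: Aut_mod_def)

lemma one_Aut_mod [simp]: "\<one>\<^bsub>Aut_mod R N\<^esub> = (\<lambda>x\<in>carrier N. x)"
  by (simp add: Aut_mod_def BijGroup_def)

lemma mult_Aut_mod:
  "f \<in> carrier (Aut_mod R N) \<Longrightarrow> g \<in> carrier (Aut_mod R N) \<Longrightarrow>
    f \<otimes>\<^bsub>Aut_mod R N\<^esub> g = compose (carrier N) f g"
  by (simp add: Aut_mod_def BijGroup_def)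

lemma group_Aut_mod:
  assumes "module R N"
  shows "group (Aut_mod R N)"
proof -
  interpret N: module R N by fact
  interpret B: group "BijGroup (carrier N)" by (rule group_BijGroup)
  let ?A = "mod_hom R N N \<inter> Bij (carrier N)"
  have "subgroup ?A (BijGroup (carrier N))"
  proof (rule B.subgroupI)
    show "?A \<subseteq> carrier (BijGroup (carrier N))" by (auto simp: BijGroup_def)
    have "(\<lambda>x\<in>carrier N. x) \<in> ?A" by (auto simp: mod_hom_iff id_Bij)
    then show "?A \<noteq> {}" by blast
  next
    fix f assume f: "f \<in> ?A"
    then have "inv_into (carrier N) f \<in> mod_hom R N N"
      using mod_hom_inv_into[OF assms] by (auto simp: Bij_def)
    then have "(\<lambda>x\<in>carrier N. inv_into (carrier N) f x) \<in> mod_hom R N N"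
      by (auto simp: mod_hom_iff)
    then show "inv\<^bsub>BijGroup (carrier N)\<^esub> f \<in> ?A"
      using f by (auto simp: inv_BijGroup restrict_inv_into_Bij)
  next
    fix f g assume "f \<in> ?A" "g \<in> ?A"
    then show "f \<otimes>\<^bsub>BijGroup (carrier N)\<^esub> g \<in> ?A"
      by (auto simp: BijGroup_def compose_Bij mod_hom_iff compose_eq)
  qed
  then show ?thesis unfolding Aut_mod_def by (rule B.subgroup_imp_group)
qed

lemma Aut_mod_eqI:
  assumes "f \<in> carrier (Aut_mod R N)" "g \<in> carrier (Aut_mod R N)"
    and "\<And>x. x \<in> carrier N \<Longrightarrow> f x = g x"
  shows "f = g"
  using assms by (intro extensionalityI[of f "carrier N"]) (auto simp: carrier_Aut_mod Bij_def)

lemma mult_Aut_mod_apply: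
  "f \<in> carrier (Aut_mod R N) \<Longrightarrow> g \<in> carrier (Aut_mod R N) \<Longrightarrow> x \<in> carrier N \<Longrightarrow>
    (f \<otimes>\<^bsub>Aut_mod R N\<^esub> g) x = f (g x)"
  by (simp add: mult_Aut_mod compose_eq)

lemma transvection_apply [simp]:
  "p \<in> carrier N \<Longrightarrow> transvection N f q p = p \<oplus>\<^bsub>N\<^esub> f p \<odot>\<^bsub>N\<^esub> q"
  by (simp add: transvection_def)

lemma transvection_closed:
  assumes N: "module R N" and q: "q \<in> carrier N" and f: "f \<in> carrier (dual R N)" "f q = \<zero>\<^bsub>R\<^esub>"
  shows "transvection N f q \<in> carrier (Aut_mod R N)"
proof -
  interpret N: module R N by (rule N)
  have fm: "f (\<ominus>\<^bsub>N\<^esub> q) = \<zero>\<^bsub>R\<^esub>"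
    using dualD(5)[OF f(1), of "\<ominus>\<^bsub>R\<^esub> \<one>\<^bsub>R\<^esub>" q] q f(2) by (simp add: N.smult_l_minus)
  have cancel: "transvection N f q' (transvection N f q'' p) = p"
    if "q' \<in> carrier N" "q'' \<in> carrier N" "f q'' = \<zero>\<^bsub>R\<^esub>" "q'' \<oplus>\<^bsub>N\<^esub> q' = \<zero>\<^bsub>N\<^esub>" "p \<in> carrier N" for q' q'' p
    using that dualD[OF f(1)] 
    by (simp add: N.M.a_assoc N.smult_assoc1 flip: N.smult_r_distr)
  have "bij_betw (transvection N f q) (carrier N) (carrier N)"
    using q f fm dualD(3)[OF f(1)]
    by (intro bij_betw_byWitness[where f' = "transvection N f (\<ominus>\<^bsub>N\<^esub> q)"])
      (auto intro!: cancel simp: N.M.l_neg N.M.r_neg simp del: transvection_apply, auto)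
  moreover have "transvection N f q \<in> mod_hom R N N"
    using q dualD[OF f(1)]
    by (auto simp: mod_hom_iff N.smult_l_distr N.smult_r_distr N.M.a_ac N.smult_assoc1)
  ultimately show ?thesis by (auto simp: carrier_Aut_mod Bij_def transvection_def)
qed

lemma transvection_system_Aut_mod:
  assumes N: "module R N"
  shows "transvection_system R N (dual R N) (\<lambda>f x. f x) (Aut_mod R N) (\<lambda>q f. transvection N f q)"
proof -
  interpret N: module R N by (rule N)
  interpret D: module R "dual R N" by (rule module_dual[OF N])
  interpret G: group "Aut_mod R N" by (rule group_Aut_mod[OF N])
  note closed = transvection_closed[OF N]
  have hom: "(\<lambda>x\<in>carrier N. f x \<oplus>\<^bsub>R\<^esub> g x) \<in> carrier (dual R N)"
    "a \<in> carrier R \<Longrightarrow> (\<lambda>x\<in>carrier N. a \<otimes>\<^bsub>R\<^esub> f x) \<in> carrier (dual R N)"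
    if "f \<in> carrier (dual R N)" "g \<in> carrier (dual R N)" for f g a
    using D.M.a_closed[OF that] D.smult_closed[OF _ that(1)] by auto
  show ?thesis
  proof unfold_locales
    fix x y f g assume a: "x \<in> carrier N" "y \<in> carrier N" "f \<in> carrier (dual R N)" "g \<in> carrier (dual R N)"
      "f x = \<zero>\<^bsub>R\<^esub>" "g x = \<zero>\<^bsub>R\<^esub>" "g y = \<zero>\<^bsub>R\<^esub>"
    let ?k = "transvection N (f y \<odot>\<^bsub>dual R N\<^esub> g) x"
    have k: "?k \<in> carrier (Aut_mod R N)" "transvection N f x \<in> carrier (Aut_mod R N)"
        "transvection N g y \<in> carrier (Aut_mod R N)"
      using a dualD(3)[OF a(3)] by (auto intro!: closed hom)
    show "transvection N f x \<otimes>\<^bsub>Aut_mod R N\<^esub> transvection N g y =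
      ?k \<otimes>\<^bsub>Aut_mod R N\<^esub> (transvection N g y \<otimes>\<^bsub>Aut_mod R N\<^esub> transvection N f x)"
      using k
    proof (intro Aut_mod_eqI[of _ R N] G.m_closed)
      fix p assume p: "p \<in> carrier N"
      have c: "f p \<in> carrier R" "g p \<in> carrier R" "f y \<in> carrier R"
        using a p by (auto intro: dualD(3))
      show "(transvection N f x \<otimes>\<^bsub>Aut_mod R N\<^esub> transvection N g y) p =
        (?k \<otimes>\<^bsub>Aut_mod R N\<^esub> (transvection N g y \<otimes>\<^bsub>Aut_mod R N\<^esub> transvection N f x)) p"
        using k p a c dualD(4,5)[OF a(3)] dualD(4,5)[OF a(4)]
        by (simp add: mult_Aut_mod_apply N.smult_l_distr N.M.a_ac N.R.m_comm)
    qed auto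
  next
    fix x f g assume a: "x \<in> carrier N" "f \<in> carrier (dual R N)" "g \<in> carrier (dual R N)"
      "f x = \<zero>\<^bsub>R\<^esub>" "g x = \<zero>\<^bsub>R\<^esub>"
    let ?k = "transvection N (f \<oplus>\<^bsub>dual R N\<^esub> g) x"
    have k: "?k \<in> carrier (Aut_mod R N)" "transvection N f x \<in> carrier (Aut_mod R N)"
        "transvection N g x \<in> carrier (Aut_mod R N)"
      using a by (auto intro!: closed hom)
    show "?k = transvection N f x \<otimes>\<^bsub>Aut_mod R N\<^esub> transvection N g x"
      using k
    proof (intro Aut_mod_eqI[of _ R N] G.m_closed)
      fix p assume p: "p \<in> carrier N"
      have c: "f p \<in> carrier R" "g p \<in> carrier R" using a p by (auto intro: dualD(3))
      show "?k p = (transvection N f x \<otimes>\<^bsub>Aut_mod R N\<^esub> transvection N g x) p"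
        using k p a c dualD(4,5)[OF a(2)]
        by (simp add: mult_Aut_mod_apply N.smult_l_distr N.M.a_ac)
    qed auto
  next
    fix x y f assume a: "x \<in> carrier N" "y \<in> carrier N" "f \<in> carrier (dual R N)"
      "f x = \<zero>\<^bsub>R\<^esub>" "f y = \<zero>\<^bsub>R\<^esub>"
    let ?k = "transvection N f (x \<oplus>\<^bsub>N\<^esub> y)"
    have k: "?k \<in> carrier (Aut_mod R N)" "transvection N f x \<in> carrier (Aut_mod R N)"
        "transvection N f y \<in> carrier (Aut_mod R N)"
      using a dualD(4)[OF a(3)] by (auto intro!: closed)
    show "?k = transvection N f x \<otimes>\<^bsub>Aut_mod R N\<^esub> transvection N f y"
      using k
    proof (intro Aut_mod_eqI[of _ R N] G.m_closed)
      fix p assume p: "p \<in> carrier N"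
      have c: "f p \<in> carrier R" using a p by (auto intro: dualD(3))
      show "?k p = (transvection N f x \<otimes>\<^bsub>Aut_mod R N\<^esub> transvection N f y) p"
        using k p a c dualD(4,5)[OF a(3)]
        by (simp add: mult_Aut_mod_apply N.smult_r_distr N.M.a_ac)
    qed auto
  next
    fix a x f assume a: "a \<in> carrier R" "x \<in> carrier N" "f \<in> carrier (dual R N)" "f x = \<zero>\<^bsub>R\<^esub>"
    then show "transvection N f (a \<odot>\<^bsub>N\<^esub> x) = transvection N (a \<odot>\<^bsub>dual R N\<^esub> f) x"
      using dualD(3)[OF a(3)]
      by (auto simp: transvection_def restrict_def fun_eq_iff N.R.m_comm simp flip: N.smult_assoc1)
  qed (auto simp: dual_iff intro!: closed)
qed

text \<open>
  Conjugating \<open>1 + q \<otimes> f\<close> by \<open>h\<close> moves \<open>q\<close> by \<open>h\<close> and \<open>f\<close> by the transpose of the inverse of \<open>h\<close>.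
\<close>

lemma transvection_conjugate:
  assumes N: "module R N" and h: "h \<in> carrier (Aut_mod R N)"
    and q: "q \<in> carrier N" and f: "f \<in> carrier (dual R N)" "f q = \<zero>\<^bsub>R\<^esub>"
  defines "f' \<equiv> \<lambda>p\<in>carrier N. f ((inv\<^bsub>Aut_mod R N\<^esub> h) p)"
  shows "h \<otimes>\<^bsub>Aut_mod R N\<^esub> transvection N f q \<otimes>\<^bsub>Aut_mod R N\<^esub> inv\<^bsub>Aut_mod R N\<^esub> h = transvection N f' (h q)"
    and "f' \<in> carrier (dual R N)" and "f' (h q) = \<zero>\<^bsub>R\<^esub>"
proof -
  interpret N: module R N by (rule N)
  interpret G: group "Aut_mod R N" by (rule group_Aut_mod[OF N])
  let ?i = "inv\<^bsub>Aut_mod R N\<^esub> h"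
  have i: "?i \<in> carrier (Aut_mod R N)" using h by simp
  have hh: "h \<in> mod_hom R N N" and ii: "?i \<in> mod_hom R N N" using h i by (auto simp: carrier_Aut_mod)
  have hi: "h (?i p) = p" and ih: "?i (h p) = p" if "p \<in> carrier N" for p
    using mult_Aut_mod_apply[OF h i that] mult_Aut_mod_apply[OF i h that] that h by auto
  show f': "f' \<in> carrier (dual R N)"
    unfolding f'_def using mod_homD(1)[OF mod_hom_dual_pullback[OF N N ii] f(1)] .
  show f'hq: "f' (h q) = \<zero>\<^bsub>R\<^esub>" using q f(2) ih mod_homD(1)[OF hh q] by (simp add: f'_def)
  have t: "transvection N f q \<in> carrier (Aut_mod R N)" by (rule transvection_closed[OF N q f])
  have t': "transvection N f' (h q) \<in> carrier (Aut_mod R N)"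
    by (rule transvection_closed[OF N mod_homD(1)[OF hh q] f' f'hq])
  show "h \<otimes>\<^bsub>Aut_mod R N\<^esub> transvection N f q \<otimes>\<^bsub>Aut_mod R N\<^esub> ?i = transvection N f' (h q)"
  proof (rule Aut_mod_eqI[of _ R N])
    fix p assume p: "p \<in> carrier N"
    then have ip: "?i p \<in> carrier N" using mod_homD(1)[OF ii] by blast
    have fip: "f (?i p) \<in> carrier R" using dualD(3)[OF f(1) ip] .
    show "(h \<otimes>\<^bsub>Aut_mod R N\<^esub> transvection N f q \<otimes>\<^bsub>Aut_mod R N\<^esub> ?i) p = transvection N f' (h q) p"
      using h i t p ip fip q
      by (simp add: mult_Aut_mod_apply mod_homD[OF hh] hi f'_def)
  qed (use h i t t' in auto)
qed

section \<open>The sum of the ring and a module\<close>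

locale ring_plus_module =
  fixes R :: "('a, 'k) ring_scheme" and M :: "('a, 'b, 'm) module_scheme"
  assumes R: "cring R" and M: "module R M"
begin

interpretation R: cring R by (rule R)
interpretation M: module R M by (rule M)

abbreviation (input) N where "N \<equiv> direct_sum (reg_module R) M"
abbreviation (input) e where "e \<equiv> (\<one>\<^bsub>R\<^esub>, \<zero>\<^bsub>M\<^esub>)"
abbreviation (input) e' where "e' \<equiv> (\<lambda>p\<in>carrier N. fst p)"

lemmas reg = module_reg_module[OF R]
lemmas N = module_direct_sum[OF reg M]
lemmas N' = module_dual[OF N]

interpretation N: module R N by (rule N)
interpretation N': module R "dual R N" by (rule N')
interpretation G: group "Aut_mod R N" by (rule group_Aut_mod[OF N])

definition extend_dual where "extend_dual f = (\<lambda>p\<in>carrier N. f (snd p))"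
definition restrict_dual where "restrict_dual f = (\<lambda>x\<in>carrier M. f (\<zero>\<^bsub>R\<^esub>, x))"

lemma extend_dual: "extend_dual \<in> mod_hom R (dual R M) (dual R N)"
  using mod_hom_dual_pullback[OF N M mod_hom_snd[OF reg M]]
  by (simp add: extend_dual_def[abs_def])

lemma inject: "(\<lambda>x. (\<zero>\<^bsub>R\<^esub>, x)) \<in> mod_hom R M N"
  using mod_hom_inject_snd[OF reg M] by simp

lemma restrict_dual: "restrict_dual \<in> mod_hom R (dual R N) (dual R M)"
  using mod_hom_dual_pullback[OF M N inject] by (simp add: restrict_dual_def[abs_def])

lemma e: "e \<in> carrier N" by simp

lemma e': "e' \<in> carrier (dual R N)"
  by (auto simp: dual_iff)

lemma extend_restrict:
  assumes "f \<in> carrier (dual R N)"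
  shows "f = (f e \<odot>\<^bsub>dual R N\<^esub> e') \<oplus>\<^bsub>dual R N\<^esub> extend_dual (restrict_dual f)"
proof (rule extensionalityI[of _ "carrier N"])
  fix p assume p: "p \<in> carrier N"
  then obtain a x where ax: "p = (a, x)" "a \<in> carrier R" "x \<in> carrier M" by auto
  have "f p = f (a \<odot>\<^bsub>N\<^esub> e \<oplus>\<^bsub>N\<^esub> (\<zero>\<^bsub>R\<^esub>, x))" using ax by simp
  also have "\<dots> = f (a \<odot>\<^bsub>N\<^esub> e) \<oplus>\<^bsub>R\<^esub> f (\<zero>\<^bsub>R\<^esub>, x)"
    using ax by (intro dualD(4)[OF assms]) auto
  also have "f (a \<odot>\<^bsub>N\<^esub> e) = a \<otimes>\<^bsub>R\<^esub> f e" using ax by (intro dualD(5)[OF assms]) auto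
  finally show "f p = ((f e \<odot>\<^bsub>dual R N\<^esub> e') \<oplus>\<^bsub>dual R N\<^esub> extend_dual (restrict_dual f)) p"
    using ax dualD(3)[OF assms e] by (simp add: extend_dual_def restrict_dual_def R.m_comm)
qed (use dualD(2)[OF assms] in auto)

lemma extend_restrict':
  assumes "f \<in> carrier (dual R N)" "f e = \<zero>\<^bsub>R\<^esub>"
  shows "extend_dual (restrict_dual f) = f"
proof -
  have "extend_dual (restrict_dual f) \<in> carrier (dual R N)"
    using mod_homD(1)[OF extend_dual mod_homD(1)[OF restrict_dual assms(1)]] .
  moreover have "f = (\<zero>\<^bsub>R\<^esub> \<odot>\<^bsub>dual R N\<^esub> e') \<oplus>\<^bsub>dual R N\<^esub> extend_dual (restrict_dual f)"
    using extend_restrict[OF assms(1)] unfolding assms(2) .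
  ultimately show ?thesis using N'.smult_l_null[OF e'] N'.M.l_zero by metis
qed

text \<open>
  Since \<open>M\<close> is reflexive and \<open>R\<close> is free of rank one, a functional on \<open>N\<^sup>*\<close> is evaluation at an element
  of \<open>N\<close>; a unimodular \<open>f\<close> therefore takes the value \<open>\<one>\<close>.
\<close>

lemma unimodular_dual_imp:
  assumes fg: "finitely_generated R M" and proj: "projective R M"
    and f: "f \<in> unimodular R (dual R N)"
  shows "\<exists>p\<in>carrier N. f p = \<one>\<^bsub>R\<^esub>"
proof -
  from f obtain F where fN: "f \<in> carrier (dual R N)" and F: "F \<in> carrier (dual R (dual R N))" and 1: "F f = \<one>\<^bsub>R\<^esub>"
    by (auto simp: unimodular_def)
  have "(\<lambda>g\<in>carrier (dual R M). F (extend_dual g)) \<in> carrier (dual R (dual R M))"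
    using mod_homD(1)[OF mod_hom_dual_pullback[OF module_dual[OF M] N' extend_dual] F] .
  then obtain p where p: "p \<in> carrier M" "\<And>g. g \<in> carrier (dual R M) \<Longrightarrow> F (extend_dual g) = g p"
    using dual_reflexive[OF M fg proj] by force
  note rf = mod_homD(1)[OF restrict_dual fN]
  have Fe: "F e' \<in> carrier R" using dualD(3)[OF F e'] .
  have fe: "f e \<in> carrier R" using dualD(3)[OF fN e] .
  have "\<one>\<^bsub>R\<^esub> = F ((f e \<odot>\<^bsub>dual R N\<^esub> e') \<oplus>\<^bsub>dual R N\<^esub> extend_dual (restrict_dual f))"
    unfolding extend_restrict[OF fN, symmetric] by (rule 1[symmetric])
  also have "\<dots> = F (f e \<odot>\<^bsub>dual R N\<^esub> e') \<oplus>\<^bsub>R\<^esub> F (extend_dual (restrict_dual f))"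
    by (rule dualD(4)[OF F N'.smult_closed[OF fe e'] mod_homD(1)[OF extend_dual rf]])
  also have "\<dots> = f e \<otimes>\<^bsub>R\<^esub> F e' \<oplus>\<^bsub>R\<^esub> f (\<zero>\<^bsub>R\<^esub>, p)"
    unfolding dualD(5)[OF F fe e'] p(2)[OF rf] using p(1) by (simp add: restrict_dual_def)
  also have "\<dots> = f (F e' \<odot>\<^bsub>N\<^esub> e) \<oplus>\<^bsub>R\<^esub> f (\<zero>\<^bsub>R\<^esub>, p)"
    unfolding dualD(5)[OF fN Fe e] using fe Fe by (simp add: R.m_comm)
  also have "\<dots> = f (F e' \<odot>\<^bsub>N\<^esub> e \<oplus>\<^bsub>N\<^esub> (\<zero>\<^bsub>R\<^esub>, p))"
    using p(1) Fe by (intro dualD(4)[OF fN, symmetric]) auto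
  finally have "f (F e' \<odot>\<^bsub>N\<^esub> e \<oplus>\<^bsub>N\<^esub> (\<zero>\<^bsub>R\<^esub>, p)) = \<one>\<^bsub>R\<^esub>" ..
  moreover have "F e' \<odot>\<^bsub>N\<^esub> e \<oplus>\<^bsub>N\<^esub> (\<zero>\<^bsub>R\<^esub>, p) \<in> carrier N" using p(1) Fe by simp
  ultimately show ?thesis by blast
qed

lemma elementary_transvections:
  shows "x \<in> carrier M \<Longrightarrow> elem_trans R M x = transvection N e' (\<zero>\<^bsub>R\<^esub>, x)"
    and "f \<in> carrier (dual R M) \<Longrightarrow> elem_trans_dual R M f = transvection N (extend_dual f) e"
proof -
  show "elem_trans R M x = transvection N e' (\<zero>\<^bsub>R\<^esub>, x)" if "x \<in> carrier M"
    using that by (auto simp: elem_trans_def transvection_def fun_eq_iff)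
  show "elem_trans_dual R M f = transvection N (extend_dual f) e" if "f \<in> carrier (dual R M)"
    using dualD(3)[OF that]
    by (auto simp: elem_trans_dual_def transvection_def extend_dual_def fun_eq_iff)
qed

lemma transvection_eq_elementary:
  "x \<in> carrier N \<Longrightarrow> e' x = \<zero>\<^bsub>R\<^esub> \<Longrightarrow> transvection N e' x = elem_trans R M (snd x)"
  "f \<in> carrier (dual R N) \<Longrightarrow> f e = \<zero>\<^bsub>R\<^esub> \<Longrightarrow>
    transvection N f e = elem_trans_dual R M (restrict_dual f)"
  using elementary_transvections(1)[of "snd x"]
    elementary_transvections(2)[OF mod_homD(1)[OF restrict_dual, of f]]
  by (auto simp: extend_restrict')

lemma extend_dual_e:
  assumes "f \<in> carrier (dual R M)"
  shows "extend_dual f e = \<zero>\<^bsub>R\<^esub>"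
  using mod_hom_zero[OF M reg dualD(1)[OF assms]] by (simp add: extend_dual_def)

lemma elementary_closed:
  "elem_trans R M ` carrier M \<union> elem_trans_dual R M ` carrier (dual R M) \<subseteq> carrier (Aut_mod R N)"
proof safe
  fix x assume "x \<in> carrier M"
  then show "elem_trans R M x \<in> carrier (Aut_mod R N)"
    by (simp only: elementary_transvections) (intro transvection_closed[OF N _ e'], auto)
next
  fix f assume f: "f \<in> carrier (dual R M)"
  show "elem_trans_dual R M f \<in> carrier (Aut_mod R N)"
    unfolding elementary_transvections(2)[OF f]
    by (rule transvection_closed[OF N e mod_homD(1)[OF extend_dual f] extend_dual_e[OF f]])
qed

lemma subgroup_ETrans: "subgroup (ETrans R M) (Aut_mod R N)"
  unfolding ETrans_def by (rule G.generate_is_subgroup[OF elementary_closed])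

lemma ETrans_ideal_subset_ETrans:
  assumes "ideal I R"
  shows "ETrans_ideal R M I \<subseteq> ETrans R M"
  unfolding ETrans_def ETrans_ideal_def
  using ideal_smult_subset[OF M assms] ideal_smult_subset[OF module_dual[OF M] assms]
  by (intro G.mono_generate) auto

lemma elementary_pair_direct_sum:
  assumes I: "ideal I R"
    and H: "H \<lhd> Aut_mod R N\<lparr>carrier := ETrans R M\<rparr>" "ETrans_ideal R M I \<subseteq> H"
  shows "elementary_pair R N (dual R N) (\<lambda>f x. f x) (Aut_mod R N) (\<lambda>q f. transvection N f q)
    e e' (ideal_smult R I N) (ideal_smult R I (dual R N)) (ETrans R M) H"
proof (intro elementary_pair.intro elementary_pair_axioms.intro)
  show "transvection_system R N (dual R N) (\<lambda>f x. f x) (Aut_mod R N) (\<lambda>q f. transvection N f q)"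
    by (rule transvection_system_Aut_mod[OF N])
  show "e \<in> carrier N" "e' \<in> carrier (dual R N)" by (rule e e')+
  show "e' e = \<one>\<^bsub>R\<^esub>" by simp
  show "submodule (ideal_smult R I N) R N" "submodule (ideal_smult R I (dual R N)) R (dual R N)"
    by (rule submodule_ideal_smult[OF N I] submodule_ideal_smult[OF N' I])+
  have val: "f x \<in> I" if "x \<in> ideal_smult R I N" "f \<in> carrier (dual R N)" for f x
    using mod_hom_ideal_smult[OF N reg I dualD(1)[OF that(2)] that(1)] ideal_smult_reg_module[OF R I] by blast
  have val': "f x \<in> I" if "f \<in> ideal_smult R I (dual R N)" "x \<in> carrier N" for f x
    using mod_hom_ideal_smult[OF N' reg I mod_hom_eval[OF N that(2)] that(1)] ideal_smult_reg_module[OF R I] by blast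
  {
    fix x f y assume "x \<in> ideal_smult R I N" "f \<in> carrier (dual R N)" "y \<in> carrier N"
    then show "f x \<odot>\<^bsub>N\<^esub> y \<in> ideal_smult R I N" by (intro ideal_smult_smult val)
  next
    fix x f g assume "x \<in> ideal_smult R I N" "f \<in> carrier (dual R N)" "g \<in> carrier (dual R N)"
    then show "f x \<odot>\<^bsub>dual R N\<^esub> g \<in> ideal_smult R I (dual R N)" by (intro ideal_smult_smult val)
  next
    fix x f y assume "f \<in> ideal_smult R I (dual R N)" "x \<in> carrier N" "y \<in> carrier N"
    then show "f x \<odot>\<^bsub>N\<^esub> y \<in> ideal_smult R I N" by (intro ideal_smult_smult val')
  next
    fix x f g assume "f \<in> ideal_smult R I (dual R N)" "x \<in> carrier N" "g \<in> carrier (dual R N)"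
    then show "f x \<odot>\<^bsub>dual R N\<^esub> g \<in> ideal_smult R I (dual R N)" by (intro ideal_smult_smult val')
  }
  show "subgroup (ETrans R M) (Aut_mod R N)" by (rule subgroup_ETrans)
  show "subgroup H (Aut_mod R N)"
    using G.incl_subgroup[OF subgroup_ETrans normal_imp_subgroup[OF H(1)]] .
  show "k \<otimes>\<^bsub>Aut_mod R N\<^esub> h \<otimes>\<^bsub>Aut_mod R N\<^esub> inv\<^bsub>Aut_mod R N\<^esub> k \<in> H" if "k \<in> ETrans R M" "h \<in> H" for k h
    using normal.inv_op_closed2[OF H(1), of k h] that G.m_inv_consistent[OF subgroup_ETrans] by simp
  {
    fix x assume x: "x \<in> carrier N" "e' x = \<zero>\<^bsub>R\<^esub>"
    show "transvection N e' x \<in> ETrans R M"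
      unfolding transvection_eq_elementary(1)[OF x] ETrans_def
      using x(1) by (intro generate.incl) auto
  next
    fix f assume f: "f \<in> carrier (dual R N)" "f e = \<zero>\<^bsub>R\<^esub>"
    show "transvection N f e \<in> ETrans R M"
      unfolding transvection_eq_elementary(2)[OF f] ETrans_def
      using mod_homD(1)[OF restrict_dual f(1)] by (intro generate.incl) blast
  next
    fix x assume x: "x \<in> ideal_smult R I N" "e' x = \<zero>\<^bsub>R\<^esub>"
    then have "x \<in> carrier N" using ideal_smult_subset[OF N I] by blast
    then have "transvection N e' x = elem_trans R M (snd x)" using x(2) by (rule transvection_eq_elementary)
    moreover have "snd x \<in> ideal_smult R I M"
      by (rule mod_hom_ideal_smult[OF N M I mod_hom_snd[OF reg M] x(1)])
    ultimately show "transvection N e' x \<in> H"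
      using H(2) unfolding ETrans_ideal_def by (auto intro: generate.incl)
  next
    fix f assume f: "f \<in> ideal_smult R I (dual R N)" "f e = \<zero>\<^bsub>R\<^esub>"
    then have "f \<in> carrier (dual R N)" using ideal_smult_subset[OF N' I] by blast
    then have "transvection N f e = elem_trans_dual R M (restrict_dual f)"
      using f(2) by (rule transvection_eq_elementary)
    moreover have "restrict_dual f \<in> ideal_smult R I (dual R M)"
      by (rule mod_hom_ideal_smult[OF N' module_dual[OF M] I restrict_dual f(1)])
    ultimately show "transvection N f e \<in> H"
      using H(2) unfolding ETrans_ideal_def by (auto intro: generate.incl)
  }
qed

text \<open>
  Stated for an arbitrary normal subgroup \<open>H\<close> above \<open>ETrans(IN)\<close>: intersecting over all \<open>H\<close> gives the
  relative elementary group, and \<open>H = ETrans(N)\<close> shows that \<open>Trans(N, IN)\<close> consists of elementary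
  automorphisms, which is needed for the opposite inclusion.
\<close>

lemma Trans_subset_normal:
  assumes I: "ideal I R"
    and fg: "finitely_generated R M" and proj: "projective R M" and rank: "rank_at_least R M 2"
    and H: "H \<lhd> Aut_mod R N\<lparr>carrier := ETrans R M\<rparr>" "ETrans_ideal R M I \<subseteq> H"
  shows "Trans R N I \<subseteq> H"
proof -
  interpret I: ideal I R by (rule I)
  interpret P: elementary_pair R N "dual R N" "\<lambda>f x. f x" "Aut_mod R N" "\<lambda>q f. transvection N f q"
    e e' "ideal_smult R I N" "ideal_smult R I (dual R N)" "ETrans R M" H
    by (rule elementary_pair_direct_sum[OF I H])
  interpret S: elementary_pair R "dual R N" N "\<lambda>x f. f x" "Aut_mod R N"
    "\<lambda>f q. transvection N f (\<ominus>\<^bsub>N\<^esub> q)"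
    e' e "ideal_smult R I (dual R N)" "ideal_smult R I N" "ETrans R M" H
    by (rule P.swap_pair)
  have minors: "\<exists>x\<in>carrier N. \<exists>y\<in>carrier N. \<exists>r\<in>carrier (dual R N). \<exists>s\<in>carrier (dual R N).
      e' x = \<zero>\<^bsub>R\<^esub> \<and> e' y = \<zero>\<^bsub>R\<^esub> \<and> r e = \<zero>\<^bsub>R\<^esub> \<and> s e = \<zero>\<^bsub>R\<^esub> \<and>
      r x \<otimes>\<^bsub>R\<^esub> s y \<ominus>\<^bsub>R\<^esub> r y \<otimes>\<^bsub>R\<^esub> s x \<notin> Q" if "primeideal Q R" for Q
  proof -
    obtain x y r s where m: "x \<in> carrier M" "y \<in> carrier M" "r \<in> carrier (dual R M)" "s \<in> carrier (dual R M)"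
      "r x \<otimes>\<^bsub>R\<^esub> s y \<ominus>\<^bsub>R\<^esub> r y \<otimes>\<^bsub>R\<^esub> s x \<notin> Q"
      using minor_notin_prime[OF M fg proj rank \<open>primeideal Q R\<close>] by blast
    show ?thesis
      by (rule bexI[of _ "(\<zero>\<^bsub>R\<^esub>, x)"], rule bexI[of _ "(\<zero>\<^bsub>R\<^esub>, y)"],
          rule bexI[OF _ mod_homD(1)[OF extend_dual m(3)]],
          rule bexI[OF _ mod_homD(1)[OF extend_dual m(4)]])
        (use m extend_dual_e[OF m(3)] extend_dual_e[OF m(4)] in \<open>simp_all add: extend_dual_def\<close>)
  qed
  have minors': "\<exists>x\<in>carrier (dual R N). \<exists>y\<in>carrier (dual R N). \<exists>r\<in>carrier N. \<exists>s\<in>carrier N.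
      x e = \<zero>\<^bsub>R\<^esub> \<and> y e = \<zero>\<^bsub>R\<^esub> \<and> e' r = \<zero>\<^bsub>R\<^esub> \<and> e' s = \<zero>\<^bsub>R\<^esub> \<and>
      x r \<otimes>\<^bsub>R\<^esub> y s \<ominus>\<^bsub>R\<^esub> y r \<otimes>\<^bsub>R\<^esub> x s \<notin> Q" if Q: "primeideal Q R" for Q
  proof -
    obtain x y r s where m: "x \<in> carrier N" "y \<in> carrier N" "r \<in> carrier (dual R N)" "s \<in> carrier (dual R N)"
      "e' x = \<zero>\<^bsub>R\<^esub>" "e' y = \<zero>\<^bsub>R\<^esub>" "r e = \<zero>\<^bsub>R\<^esub>" "s e = \<zero>\<^bsub>R\<^esub>"
      "r x \<otimes>\<^bsub>R\<^esub> s y \<ominus>\<^bsub>R\<^esub> r y \<otimes>\<^bsub>R\<^esub> s x \<notin> Q"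
      using minors[OF Q] by blast
    have "r y \<otimes>\<^bsub>R\<^esub> s x = s x \<otimes>\<^bsub>R\<^esub> r y"
      using dualD(3)[OF m(3,2)] dualD(3)[OF m(4,1)] by (rule R.m_comm)
    then have "r x \<otimes>\<^bsub>R\<^esub> s y \<ominus>\<^bsub>R\<^esub> s x \<otimes>\<^bsub>R\<^esub> r y \<notin> Q" using m(9) by simp
    then show ?thesis
      by (intro bexI[OF bexI[OF bexI[OF bexI[OF _ m(2)] m(1)] m(4)] m(3)] conjI m(5-8))
  qed
  \<comment> \<open>\<open>q\<close> unimodular in \<open>IN\<close>, or \<open>f\<close> unimodular in \<open>IN\<^sup>*\<close>, puts \<open>\<one>\<close> into \<open>I\<close>, and then all vectors and functionals are in \<open>IN\<close> and \<open>IN\<^sup>*\<close>\<close>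
  have one: "I = carrier R" if "\<one>\<^bsub>R\<^esub> \<in> I"
    using I.one_imp_carrier that by blast
  have full: "ideal_smult R (carrier R) K = carrier K" if "module R K" for K :: "('a, 'c) module"
    using ideal_smult_carrier[OF that] R.oneideal by blast
  have left: "transvection N f q \<in> H"
    if f: "f \<in> carrier (dual R N)" and fq: "f q = \<zero>\<^bsub>R\<^esub>" and "q \<in> unimodular R N"
      and IN: "q \<in> ideal_smult R I N \<or> f \<in> ideal_smult R I (dual R N)" for f q
  proof -
    from \<open>q \<in> unimodular R N\<close> obtain g where q: "q \<in> carrier N"
      and g: "g \<in> carrier (dual R N)" "g q = \<one>\<^bsub>R\<^esub>" by (auto simp: unimodular_def)
    have "f \<in> ideal_smult R I (dual R N)"
    proof (cases "q \<in> ideal_smult R I N")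
      case True
      then have "g q \<in> I"
        using mod_hom_ideal_smult[OF N reg I dualD(1)[OF g(1)]] ideal_smult_reg_module[OF R I] by blast
      then show ?thesis using one g(2) f full[OF N'] by simp
    qed (use IN in auto)
    then show ?thesis
      using P.t_unimodular_mem_H[OF q g] fq minors by blast
  qed
  have right: "transvection N f q \<in> H"
    if q: "q \<in> carrier N" and fq: "f q = \<zero>\<^bsub>R\<^esub>" and f_uni: "f \<in> unimodular R (dual R N)"
      and IN: "q \<in> ideal_smult R I N \<or> f \<in> ideal_smult R I (dual R N)" for f q
  proof -
    have f: "f \<in> carrier (dual R N)" using f_uni by (simp only: unimodular_def mem_Collect_eq)
    obtain p where p: "p \<in> carrier N" "f p = \<one>\<^bsub>R\<^esub>"
      using unimodular_dual_imp[OF fg proj f_uni] by blast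
    have "q \<in> ideal_smult R I N"
    proof (cases "f \<in> ideal_smult R I (dual R N)")
      case True
      then have "f p \<in> I"
        using mod_hom_ideal_smult[OF N' reg I mod_hom_eval[OF N p(1)]] ideal_smult_reg_module[OF R I] by blast
      then show ?thesis using one p(2) q full[OF N] by simp
    qed (use IN in auto)
    then have "\<ominus>\<^bsub>N\<^esub> q \<in> ideal_smult R I N" by (rule N.submoduleE(3)[OF P.J])
    moreover have "f (\<ominus>\<^bsub>N\<^esub> q) = \<zero>\<^bsub>R\<^esub>" using P.B_neg_right[OF f q] fq by simp
    ultimately have "transvection N f (\<ominus>\<^bsub>N\<^esub> (\<ominus>\<^bsub>N\<^esub> q)) \<in> H"
      using S.t_unimodular_mem_H[OF f p] minors' by blast
    then show ?thesis using q by (simp only: N.M.minus_minus)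
  qed
  show ?thesis
    unfolding Trans_def by (rule G.generate_subgroup_incl[OF _ P.H]) (use left right in blast)
qed

text \<open>
  An automorphism and its transpose preserve unimodularity and the submodules \<open>IN\<close>, \<open>IN\<^sup>*\<close>, so
  conjugation permutes the generators.
\<close>

lemma Trans_normal:
  assumes I: "ideal I R"
  shows "Trans R N I \<lhd> Aut_mod R N"
  unfolding Trans_def
proof (rule G.normal_generateI)
  let ?T = "{transvection N f q | f q. q \<in> carrier N \<and> f \<in> carrier (dual R N) \<and> f q = \<zero>\<^bsub>R\<^esub> \<and>
      (q \<in> unimodular R N \<or> f \<in> unimodular R (dual R N)) \<and>
      (q \<in> ideal_smult R I N \<or> f \<in> ideal_smult R I (dual R N))}"
  show "?T \<subseteq> carrier (Aut_mod R N)" using transvection_closed[OF N] by blast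
  fix t h assume h: "h \<in> carrier (Aut_mod R N)" and "t \<in> ?T"
  then obtain f q where t: "t = transvection N f q" and q: "q \<in> carrier N"
    and f: "f \<in> carrier (dual R N)" "f q = \<zero>\<^bsub>R\<^esub>"
    and un: "q \<in> unimodular R N \<or> f \<in> unimodular R (dual R N)"
    and id: "q \<in> ideal_smult R I N \<or> f \<in> ideal_smult R I (dual R N)"
    by blast
  let ?i = "inv\<^bsub>Aut_mod R N\<^esub> h"
  have i: "?i \<in> carrier (Aut_mod R N)" using h by (rule G.inv_closed)
  have hh: "h \<in> mod_hom R N N" and ii: "?i \<in> mod_hom R N N" using h i by (auto simp: carrier_Aut_mod)
  have ih: "?i (h p) = p" if "p \<in> carrier N" for p
    using mult_Aut_mod_apply[OF i h that] that h by simp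
  define pull where "pull k g = (\<lambda>p\<in>carrier N. g (k p))"
    for k :: "'a \<times> 'b \<Rightarrow> 'a \<times> 'b" and g :: "'a \<times> 'b \<Rightarrow> 'a"
  have pull: "pull k \<in> mod_hom R (dual R N) (dual R N)" if "k \<in> mod_hom R N N" for k
    using mod_hom_dual_pullback[OF N N that] by (simp add: pull_def[abs_def])
  note conj = transvection_conjugate[OF N h q f, folded pull_def]
  have hq: "h q \<in> carrier N" using mod_homD(1)[OF hh q] .
  have pp: "pull h (pull ?i g) = g" if "g \<in> carrier (dual R N)" for g
    using dualD(2)[OF that] mod_homD(1)[OF hh] ih
    by (intro extensionalityI[of _ "carrier N"]) (auto simp: pull_def simp del: direct_sum_simps)
  have "h q \<in> unimodular R N \<or> pull ?i f \<in> unimodular R (dual R N)"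
    using un
  proof
    assume "q \<in> unimodular R N"
    then obtain g where g: "g \<in> carrier (dual R N)" "g q = \<one>\<^bsub>R\<^esub>" by (auto simp: unimodular_def)
    have "pull ?i g (h q) = \<one>\<^bsub>R\<^esub>" using hq g ih[OF q] by (simp add: pull_def del: direct_sum_simps)
    then show ?thesis using hq mod_homD(1)[OF pull[OF ii] g(1)] unfolding unimodular_def by blast
  next
    assume "f \<in> unimodular R (dual R N)"
    then obtain F where F: "F \<in> carrier (dual R (dual R N))" "F f = \<one>\<^bsub>R\<^esub>" by (auto simp: unimodular_def)
    let ?F = "\<lambda>g\<in>carrier (dual R N). F (pull h g)"
    have "?F \<in> carrier (dual R (dual R N))"
      using mod_homD(1)[OF mod_hom_dual_pullback[OF N' N' pull[OF hh]] F(1)] .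
    moreover have "?F (pull ?i f) = \<one>\<^bsub>R\<^esub>" using conj(2) F(2) pp[OF f(1)] by simp
    ultimately show ?thesis using conj(2) unfolding unimodular_def by blast
  qed
  moreover have "h q \<in> ideal_smult R I N \<or> pull ?i f \<in> ideal_smult R I (dual R N)"
    using id mod_hom_ideal_smult[OF N N I hh] mod_hom_ideal_smult[OF N' N' I pull[OF ii]] by blast
  ultimately show "h \<otimes>\<^bsub>Aut_mod R N\<^esub> t \<otimes>\<^bsub>Aut_mod R N\<^esub> ?i \<in> ?T"
    using conj hq unfolding t by blast
qed

lemma ETrans_ideal_subset_Trans:
  assumes I: "ideal I R"
  shows "ETrans_ideal R M I \<subseteq> Trans R N I"
  unfolding ETrans_ideal_def
proof (rule G.generate_subgroup_incl[OF _ normal_imp_subgroup[OF Trans_normal[OF I]]], safe)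
  fix x assume x: "x \<in> ideal_smult R I M"
  then have xM: "x \<in> carrier M" using ideal_smult_subset[OF M I] by blast
  have "(\<lambda>f\<in>carrier (dual R N). f e) \<in> carrier (dual R (dual R N))"
    using mod_hom_eval[OF N e] N'.a_closed N'.smult_closed
    by (auto simp: dual_def[of R "dual R N"] mod_hom_iff simp del: dual_simps direct_sum_simps)
  then have "e' \<in> unimodular R (dual R N)"
    using e' e unfolding unimodular_def
    by (intro CollectI conjI bexI[of _ "\<lambda>f\<in>carrier (dual R N). f e"])
      (simp_all del: direct_sum_simps(1))
  moreover have "(\<zero>\<^bsub>R\<^esub>, x) \<in> ideal_smult R I N"
    by (rule mod_hom_ideal_smult[OF M N I inject x])
  moreover have "(\<zero>\<^bsub>R\<^esub>, x) \<in> carrier N" "e' (\<zero>\<^bsub>R\<^esub>, x) = \<zero>\<^bsub>R\<^esub>" using xM by simp_all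
  ultimately show "elem_trans R M x \<in> Trans R N I"
    unfolding elementary_transvections(1)[OF xM] Trans_def using e' by (intro generate.incl) blast
next
  fix f assume f: "f \<in> ideal_smult R I (dual R M)"
  then have fM: "f \<in> carrier (dual R M)" using ideal_smult_subset[OF module_dual[OF M] I] by blast
  have "e \<in> unimodular R N" using e' by (auto simp: unimodular_def intro!: bexI[of _ e'])
  moreover have "extend_dual f \<in> ideal_smult R I (dual R N)"
    by (rule mod_hom_ideal_smult[OF module_dual[OF M] N' I extend_dual f])
  moreover have "extend_dual f e = \<zero>\<^bsub>R\<^esub>"
    by (rule extend_dual_e[OF fM])
  ultimately show "elem_trans_dual R M f \<in> Trans R N I"
    unfolding elementary_transvections(2)[OF fM] Trans_def
    using e mod_homD(1)[OF extend_dual fM] by (intro generate.incl) blast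
qed

lemma Trans_eq_ETrans_rel:
  assumes I: "ideal I R"
    and fg: "finitely_generated R M" and proj: "projective R M" and rank: "rank_at_least R M 2"
  shows "Trans R N I = ETrans_rel R M I"
proof
  show "Trans R N I \<subseteq> ETrans_rel R M I"
    unfolding ETrans_rel_def normal_closure_def
    using Trans_subset_normal[OF I fg proj rank] by blast
next
  let ?E = "Aut_mod R N\<lparr>carrier := ETrans R M\<rparr>"
  interpret E: group ?E using G.subgroup_imp_group[OF subgroup_ETrans] .
  have "ETrans R M \<lhd> ?E" using E.normal_self by simp
  then have sub: "Trans R N I \<subseteq> ETrans R M"
    by (rule Trans_subset_normal[OF I fg proj rank _ ETrans_ideal_subset_ETrans[OF I]])
  have "Trans R N I \<lhd> ?E"
    using G.subgroup_incl[OF normal_imp_subgroup[OF Trans_normal[OF I]] subgroup_ETrans sub]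
      normal.inv_op_closed2[OF Trans_normal[OF I]] G.m_inv_consistent[OF subgroup_ETrans]
      subgroup.subset[OF subgroup_ETrans]
    by (intro E.normal_invI) auto
  then show "ETrans_rel R M I \<subseteq> Trans R N I"
    unfolding ETrans_rel_def normal_closure_def
    using ETrans_ideal_subset_Trans[OF I] by blast
qed

end

theorem proposition4p10:
  fixes R :: "('a, 'k) ring_scheme" and M :: "('a, 'b, 'm) module_scheme"
  assumes "cring R" and "ideal I R"
    and "module R M" and "finitely_generated R M" and "projective R M" and "rank_at_least R M 2"
  shows "Trans R (direct_sum (reg_module R) M) I = ETrans_rel R M I"
  using assms by (intro ring_plus_module.Trans_eq_ETrans_rel ring_plus_module.intro)

end
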